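(* Let $f$ be the exact solution of the homogeneous Neumann problem described in the context, and assume that $f$ is sufficiently smooth and $\Delta t=h_1=h_2$. Let $f_{h,i,j}^n$ be the numerical solution of the reflective scheme described in the context, let $e_{i,j}^n=f_{h,i,j}^n-f(x_i,y_j,t_n)$ and $\|e^n\|_\infty=\max_{0\le i\le M_1,\,0\le j\le M_2}|e_{i,j}^n|$. Then the scheme satisfies $$\|e^n\|_\infty\le O(\Delta t^{1/2}).$$
   Context: **Problem.** $\Omega=(x_0,x_{M_1})\times(y_0,y_{M_2})$ is a fixed open rectangle and $T>0$. The functions $\rho,\sigma_1,\sigma_2,r,b_1,b_2$ are continuous on $\Omega\times[0,T)$, with $\rho\in[-1,1]$, $\sigma_1>0$, $\sigma_2>0$, $r\ge0$. The function $f$ solves $$\partial_t f+\tfrac12\sigma_1^2\,\partial_{xx}f+\rho\sigma_1\sigma_2\,\partial_{xy}f+\tfrac12\sigma_2^2\,\partial_{yy}f+b_1\partial_xf+b_2\partial_yf-rf=0\quad\text{on }\Omega\times[0,T),$$ with $f(x,y,T)=\varphi(x,y)$ on $\Omega$ and $\partial f/\partial n=0$ (normal derivative) on $\partial\Omega$ for $t\in[0,T)$. **Grid.** $h_1=(x_{M_1}-x_0)/M_1$, $h_2=(y_{M_2}-y_0)/M_2$, $\Delta t=T/N$; $x_i=x_0+ih_1$ ($0\le i\le M_1$), $y_j=y_0+jh_2$ ($0\le j\le M_2$), $t_n=n\Delta t$ ($0\le n\le N$). **Proposed branch points.** Put $\theta=\tfrac12\arcsin\rho\in[-\pi/4,\pi/4]$.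 At a node $(x_i,y_j)$ with $1\le i\le M_1-1$, $1\le j\le M_2-1$ and $0\le n\le N-1$, write $\sigma_k,b_k,r$ for the values at $(x_i,y_j,t_n)$ and $\alpha=\sin\theta+\cos\theta$, $\beta=\sin\theta-\cos\theta$ with $\theta$ evaluated at $(x_i,y_j,t_n)$. Define $$\begin{aligned}(x_1^*,y_1^* )&=(x_i+b_1\Delta t+\alpha\sigma_1\sqrt{\Delta t},\;y_j+b_2\Delta t+\alpha\sigma_2\sqrt{\Delta t}),\\(x_2^*,y_2^* )&=(x_i+b_1\Delta t-\beta\sigma_1\sqrt{\Delta t},\;y_j+b_2\Delta t+\beta\sigma_2\sqrt{\Delta t}),\\(x_3^*,y_3^* )&=(x_i+b_1\Delta t-\alpha\sigma_1\sqrt{\Delta t},\;y_j+b_2\Delta t-\alpha\sigma_2\sqrt{\Delta t}),\\(x_4^*,y_4^* )&=(x_i+b_1\Delta t+\beta\sigma_1\sqrt{\Delta t},\;y_j+b_2\Delta t-\beta\sigma_2\sqrt{\Delta t}).\end{aligned}$$ **Reflection.** $X_k^h=2x_0-x_k^*$ if $x_k^*<x_0$, $X_k^h=2x_{M_1}-x_k^*$ if $x_k^*>x_{M_1}$, and $X_k^h=x_k^*$ otherwise; $Y_k^h=2y_0-y_k^*$ if $y_k^*<y_0$, $Y_k^h=2y_{M_2}-y_k^*$ if $y_k^*>y_{M_2}$, and $Y_k^h=y_k^*$ otherwise. **Interpolation.** $\mathcal L^{\mathrm{sp}}g(x,y,t_m)$ is the bilinear interpolant in space, at time level $t_m$, of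 the grid values of $g$ at the four vertices of the grid cell containing $(x,y)$. **Scheme.** $f_{h,i,j}^N=\varphi(x_i,y_j)$ at all nodes. For $n=N-1,\dots,0$: for $1\le i\le M_1-1$, $1\le j\le M_2-1$, $$f_{h,i,j}^n=\frac{1}{4(1+r\Delta t)}\sum_{k=1}^4\mathcal L^{\mathrm{sp}}f_h(X_k^h,Y_k^h,t_{n+1}),$$ and the boundary values are $f_{h,0,j}^n=f_{h,1,j}^n$ and $f_{h,M_1,j}^n=f_{h,M_1-1,j}^n$ for $0\le j\le M_2$, and $f_{h,i,0}^n=f_{h,i,1}^n$ and $f_{h,i,M_2}^n=f_{h,i,M_2-1}^n$ for $0\le i\le M_1$.
   Formalization: Added: σ₁, σ₂, b₁, b₂ are bounded on Ω×[0,T) (with σ₁=x^{-1/2} near the boundary the claim is false), and φ is continuous on the closed rectangle, since the scheme uses its boundary values; "sufficiently smooth" is read as C³ on the closed cylinder. *)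

theory Defs
  imports "HOL-Analysis.Analysis"
begin

(* C^k up to the boundary of S, with g the gradient of f.  The derivatives are
   one-sided on the frontier of S; they are unique when S is convex with
   nonempty interior. *)
primrec Ck_on :: "nat \<Rightarrow> ('a::euclidean_space \<Rightarrow> real) \<Rightarrow> 'a set \<Rightarrow> bool" where
  "Ck_on 0 f S \<longleftrightarrow> continuous_on S f"
| "Ck_on (Suc k) f S \<longleftrightarrow>
     (\<exists>g. (\<forall>p\<in>S. (f has_derivative (\<lambda>v. g p \<bullet> v)) (at p within S)) \<and>
          (\<forall>e\<in>Basis. Ck_on k (\<lambda>p. g p \<bullet> e) S))"

type_synonym field = "real \<Rightarrow> real \<Rightarrow> real \<Rightarrow> real"

definition partial_x :: "field \<Rightarrow> field" where
  "partial_x f x y t = deriv (\<lambda>s. f s y t) x"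

definition partial_y :: "field \<Rightarrow> field" where
  "partial_y f x y t = deriv (\<lambda>s. f x s t) y"

(* one-sided at t = 0, where the equation is still required to hold *)
definition partial_t :: "real \<Rightarrow> field \<Rightarrow> field" where
  "partial_t T f x y t = vector_derivative (\<lambda>s. f x y s) (at t within {0..T})"

definition satisfies_pde ::
  "real \<Rightarrow> real \<Rightarrow> real \<Rightarrow> real \<Rightarrow> real \<Rightarrow> field \<Rightarrow> field \<Rightarrow> field \<Rightarrow> field \<Rightarrow> field \<Rightarrow> field \<Rightarrow> field \<Rightarrow> bool" where
  "satisfies_pde xL xR yL yR T \<rho> \<sigma>1 \<sigma>2 r b1 b2 f \<longleftrightarrow>
     (\<forall>x\<in>{xL<..<xR}. \<forall>y\<in>{yL<..<yR}. \<forall>t\<in>{0..<T}.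
        partial_t T f x y t
        + 1/2 * (\<sigma>1 x y t)\<^sup>2 * partial_x (partial_x f) x y t
        + \<rho> x y t * \<sigma>1 x y t * \<sigma>2 x y t * partial_x (partial_y f) x y t
        + 1/2 * (\<sigma>2 x y t)\<^sup>2 * partial_y (partial_y f) x y t
        + b1 x y t * partial_x f x y t
        + b2 x y t * partial_y f x y t
        - r x y t * f x y t = 0)"

(* The normal is not defined at the four corners, so only the open edges occur. *)
definition homogeneous_neumann ::
  "real \<Rightarrow> real \<Rightarrow> real \<Rightarrow> real \<Rightarrow> real \<Rightarrow> field \<Rightarrow> bool" where
  "homogeneous_neumann xL xR yL yR T f \<longleftrightarrow>
     (\<forall>t\<in>{0..<T}.
        (\<forall>x\<in>{xL, xR}. \<forall>y\<in>{yL<..<yR}.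
           ((\<lambda>s. f s y t) has_real_derivative 0) (at x within {xL..xR})) \<and>
        (\<forall>y\<in>{yL, yR}. \<forall>x\<in>{xL<..<xR}.
           ((\<lambda>s. f x s t) has_real_derivative 0) (at y within {yL..yR})))"

definition mesh :: "real \<Rightarrow> real \<Rightarrow> nat \<Rightarrow> real" where
  "mesh a b M = (b - a) / real M"

definition node :: "real \<Rightarrow> real \<Rightarrow> nat \<Rightarrow> nat \<Rightarrow> real" where
  "node a b M i = a + real i * mesh a b M"

definition branch_points ::
  "real \<Rightarrow> real \<Rightarrow> real \<Rightarrow> real \<Rightarrow> real \<Rightarrow> real \<Rightarrow> real \<Rightarrow> real \<Rightarrow> (real \<times> real) list" where
  "branch_points x y dt \<rho> \<sigma>1 \<sigma>2 b1 b2 =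
     (let \<theta> = 1/2 * arcsin \<rho>; \<alpha> = sin \<theta> + cos \<theta>; \<beta> = sin \<theta> - cos \<theta> in
      [(x + b1 * dt + \<alpha> * \<sigma>1 * sqrt dt, y + b2 * dt + \<alpha> * \<sigma>2 * sqrt dt),
       (x + b1 * dt - \<beta> * \<sigma>1 * sqrt dt, y + b2 * dt + \<beta> * \<sigma>2 * sqrt dt),
       (x + b1 * dt - \<alpha> * \<sigma>1 * sqrt dt, y + b2 * dt - \<alpha> * \<sigma>2 * sqrt dt),
       (x + b1 * dt + \<beta> * \<sigma>1 * sqrt dt, y + b2 * dt - \<beta> * \<sigma>2 * sqrt dt)])"

definition reflect :: "real \<Rightarrow> real \<Rightarrow> real \<Rightarrow> real" where
  "reflect a b z = (if z < a then 2 * a - z else if z > b then 2 * b - z else z)"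

(* For z in [a, b], the index i < M of a cell [node i, node (i+1)] containing z.
   The interpolant is continuous, so the choice at shared vertices is irrelevant.
   Outside [a, b] the interpolant extrapolates from some cell. *)
definition cell_index :: "real \<Rightarrow> real \<Rightarrow> nat \<Rightarrow> real \<Rightarrow> nat" where
  "cell_index a b M z = min (M - 1) (nat \<lfloor>(z - a) / mesh a b M\<rfloor>)"

definition bilinear ::
  "real \<Rightarrow> real \<Rightarrow> real \<Rightarrow> real \<Rightarrow> nat \<Rightarrow> nat \<Rightarrow> (nat \<Rightarrow> nat \<Rightarrow> real) \<Rightarrow> real \<Rightarrow> real \<Rightarrow> real" where
  "bilinear xL xR yL yR M1 M2 g x y =
     (let i = cell_index xL xR M1 x; j = cell_index yL yR M2 y;
          u = (x - node xL xR M1 i) / mesh xL xR M1;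
          v = (y - node yL yR M2 j) / mesh yL yR M2
      in (1 - u) * (1 - v) * g i j + u * (1 - v) * g (Suc i) j
         + (1 - u) * v * g i (Suc j) + u * v * g (Suc i) (Suc j))"

(* fh n i j is the numerical value at (x_i, y_j, t_n). *)
definition reflective_scheme ::
  "real \<Rightarrow> real \<Rightarrow> real \<Rightarrow> real \<Rightarrow> real \<Rightarrow> field \<Rightarrow> field \<Rightarrow> field \<Rightarrow> field \<Rightarrow> field \<Rightarrow> field \<Rightarrow>
   (real \<Rightarrow> real \<Rightarrow> real) \<Rightarrow> nat \<Rightarrow> nat \<Rightarrow> nat \<Rightarrow> (nat \<Rightarrow> nat \<Rightarrow> nat \<Rightarrow> real) \<Rightarrow> bool" where
  "reflective_scheme xL xR yL yR T \<rho> \<sigma>1 \<sigma>2 r b1 b2 \<phi> M1 M2 N fh \<longleftrightarrow>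
     (\<forall>i\<le>M1. \<forall>j\<le>M2. fh N i j = \<phi> (node xL xR M1 i) (node yL yR M2 j)) \<and>
     (\<forall>n<N.
        (\<forall>i\<in>{1..M1-1}. \<forall>j\<in>{1..M2-1}.
           (let dt = mesh 0 T N;
                x = node xL xR M1 i; y = node yL yR M2 j; t = node 0 T N n
            in fh n i j =
                 1 / (4 * (1 + r x y t * dt)) *
                 (\<Sum>(p, q)\<leftarrow>branch_points x y dt (\<rho> x y t) (\<sigma>1 x y t) (\<sigma>2 x y t) (b1 x y t) (b2 x y t).
                    bilinear xL xR yL yR M1 M2 (fh (Suc n)) (reflect xL xR p) (reflect yL yR q)))) \<and>
        (\<forall>j\<le>M2. fh n 0 j = fh n 1 j \<and> fh n M1 j = fh n (M1 - 1) j) \<and>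
        (\<forall>i\<le>M1. fh n i 0 = fh n i 1 \<and> fh n i M2 = fh n i (M2 - 1)))"

definition max_error ::
  "real \<Rightarrow> real \<Rightarrow> real \<Rightarrow> real \<Rightarrow> real \<Rightarrow> nat \<Rightarrow> nat \<Rightarrow> nat \<Rightarrow> field \<Rightarrow> (nat \<Rightarrow> nat \<Rightarrow> nat \<Rightarrow> real) \<Rightarrow> nat \<Rightarrow> real" where
  "max_error xL xR yL yR T M1 M2 N f fh n =
     Max ((\<lambda>(i, j). \<bar>fh n i j - f (node xL xR M1 i) (node yL yR M2 j) (node 0 T N n)\<bar>)
          ` ({0..M1} \<times> {0..M2}))"

lemma reflective_scheme_exists:
  assumes "M1 \<ge> 2" "M2 \<ge> 2"
  shows "\<exists>fh. reflective_scheme xL xR yL yR T \<rho> \<sigma>1 \<sigma>2 r b1 b2 \<phi> M1 M2 N fh"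
proof -
  define S where "S n g i j =
     (let dt = mesh 0 T N; x = node xL xR M1 i; y = node yL yR M2 j; t = node 0 T N n
      in 1 / (4 * (1 + r x y t * dt)) *
         (\<Sum>(p, q)\<leftarrow>branch_points x y dt (\<rho> x y t) (\<sigma>1 x y t) (\<sigma>2 x y t) (b1 x y t) (b2 x y t).
            bilinear xL xR yL yR M1 M2 g (reflect xL xR p) (reflect yL yR q)))" for n g i j
  define c where "c M i = max 1 (min (M - 1) i)" for M i :: nat
  define G where "G = rec_nat (\<lambda>i j. \<phi> (node xL xR M1 i) (node yL yR M2 j))
     (\<lambda>m g i j. S (N - Suc m) g (c M1 i) (c M2 j))"
  have G0: "G 0 i j = \<phi> (node xL xR M1 i) (node yL yR M2 j)" for i j
    by (simp add: G_def)
  have GS: "G (N - n) i j = S n (G (N - Suc n)) (c M1 i) (c M2 j)" if "n < N" for n i j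
  proof -
    have "N - n = Suc (N - Suc n)" "N - Suc (N - Suc n) = n" using that by auto
    then show ?thesis by (simp add: G_def)
  qed
  have c: "c M 0 = c M 1" "c M M = c M (M - 1)" "i \<in> {1..M-1} \<Longrightarrow> c M i = i"
    if "M \<ge> 2" for M i :: nat
    using that by (auto simp: c_def)
  have "reflective_scheme xL xR yL yR T \<rho> \<sigma>1 \<sigma>2 r b1 b2 \<phi> M1 M2 N (\<lambda>n. G (N - n))"
    unfolding reflective_scheme_def
    using c[OF assms(1)] c[OF assms(2)]
    by (simp add: G0 GS S_def Let_def)
  then show ?thesis by blast
qed

end

theory Submission
  imports Defs
begin

text \<open>
  The scheme replaces the diffusion by four equally likely branches, and the proof is consistency plus
  stability.

  Stability is the maximum principle: the scheme forms averages with nonnegative weights, divided by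
  \<open>1 + r \<Delta>t \<ge> 1\<close>, so one step passes the maximal error on without amplifying it
  (\<open>bilinear_abs_le\<close>).

  For consistency, expand the exact solution along the branches. Their first and second moments are
  \<open>b \<Delta>t\<close> and \<open>\<Delta>t\<close> times the covariance of the diffusion, up to \<open>\<Delta>t\<^sup>2\<close>, because \<open>\<alpha>\<^sup>2 + \<beta>\<^sup>2 = 2\<close> and
  \<open>\<alpha>\<^sup>2 - \<beta>\<^sup>2 = 2 \<rho>\<close>. The second-order Taylor polynomials thus add up to the differential operator, which the
  equation turns into \<open>r f\<close>. Since the displacements have size \<open>\<surd>\<Delta>t\<close>, the third-order remainders are of
  order \<open>\<Delta>t\<^bsup>3/2\<^esup>\<close> (\<open>branch_sum_consistent\<close>).

  The delicate point is a branch that leaves the rectangle and is reflected. Evaluating the solution at the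
  reflected point is evaluating its even extension at the unreflected one. Under the Neumann condition
  this extension has Lipschitz second derivatives, so the same expansion with the unreflected
  displacement holds (\<open>reflected_taylor_second_order\<close>). In two dimensions the coefficient \<open>f\<^sub>x\<close> is also carried
  along a reflected path in \<open>y\<close>, which requires \<open>f\<^sub>x\<^sub>y = 0\<close> on the horizontal walls; this follows from
  \<open>f\<^sub>y = 0\<close> there and the symmetry of mixed derivatives (\<open>wall_xy\<close>, \<open>reflected_branch_expansion\<close>).

  Interpolation costs \<open>h\<^sup>2\<close>, and so does copying a boundary value from its interior neighbour, again by
  the Neumann condition. With \<open>h = \<Delta>t\<close> these are smaller than \<open>\<Delta>t\<^bsup>3/2\<^esup>\<close>. The local errors add up over
  \<open>T / \<Delta>t\<close> steps (\<open>error_step\<close>), which gives \<open>\<Delta>t\<^bsup>1/2\<^esup>\<close>.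
\<close>

section \<open>Taylor expansion along reflected displacements\<close>

text \<open>
  Crude remainder constants suffice here and below, so the remainders are obtained from the mean value
  inequality on the segment between the two points, applied to \<open>g\<close> minus its Taylor polynomial.
\<close>

lemma taylor_first_order:
  fixes g g' g'' :: "real \<Rightarrow> real"
  assumes g: "\<And>z. z \<in> {a..b} \<Longrightarrow> (g has_real_derivative g' z) (at z within {a..b})"
    and g': "\<And>z. z \<in> {a..b} \<Longrightarrow> (g' has_real_derivative g'' z) (at z within {a..b})"
    and K: "\<And>z. z \<in> {a..b} \<Longrightarrow> \<bar>g'' z\<bar> \<le> K"
    and x: "x \<in> {a..b}" and z: "z \<in> {a..b}"
  shows "\<bar>g z - g x - g' x * (z - x)\<bar> \<le> K * (z - x)\<^sup>2"
proof -
  let ?S = "{min x z..max x z}"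
  have S: "?S \<subseteq> {a..b}" using x z by auto
  have K0: "0 \<le> K" using K[OF x] by linarith
  have "norm ((g z - g' x * (z - x)) - (g x - g' x * (x - x))) \<le> (K * \<bar>z - x\<bar>) * norm (z - x)"
  proof (rule field_differentiable_bound[where S = ?S and f' = "\<lambda>s. g' s - g' x"])
    fix s assume s: "s \<in> ?S"
    then have s': "s \<in> {a..b}" using S by blast
    have "(g has_real_derivative g' s) (at s within ?S)"
      using g[OF s'] S by (rule DERIV_subset)
    then show "((\<lambda>s. g s - g' x * (s - x)) has_real_derivative g' s - g' x) (at s within ?S)"
      by (auto intro!: derivative_eq_intros)
    have "norm (g' s - g' x) \<le> K * norm (s - x)"
      by (rule field_differentiable_bound[OF _ g']) (use K s' x in auto)
    also have "\<dots> \<le> K * \<bar>z - x\<bar>"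
      using s K0 by (intro mult_left_mono) auto
    finally show "norm (g' s - g' x) \<le> K * \<bar>z - x\<bar>" .
  qed auto
  then show ?thesis by (simp add: power2_eq_square algebra_simps)
qed

lemma taylor_second_order:
  fixes g g' g'' g''' :: "real \<Rightarrow> real"
  assumes g: "\<And>z. z \<in> {a..b} \<Longrightarrow> (g has_real_derivative g' z) (at z within {a..b})"
    and g': "\<And>z. z \<in> {a..b} \<Longrightarrow> (g' has_real_derivative g'' z) (at z within {a..b})"
    and g'': "\<And>z. z \<in> {a..b} \<Longrightarrow> (g'' has_real_derivative g''' z) (at z within {a..b})"
    and K: "\<And>z. z \<in> {a..b} \<Longrightarrow> \<bar>g''' z\<bar> \<le> K"
    and x: "x \<in> {a..b}" and z: "z \<in> {a..b}"
  shows "\<bar>g z - g x - g' x * (z - x) - 1/2 * g'' x * (z - x)\<^sup>2\<bar> \<le> K * \<bar>z - x\<bar> ^ 3"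
proof -
  let ?S = "{min x z..max x z}"
  have S: "?S \<subseteq> {a..b}" using x z by auto
  have K0: "0 \<le> K" using K[OF x] by linarith
  have "norm ((g z - g' x * (z - x) - 1/2 * g'' x * (z - x)\<^sup>2)
      - (g x - g' x * (x - x) - 1/2 * g'' x * (x - x)\<^sup>2)) \<le> (K * (z - x)\<^sup>2) * norm (z - x)"
  proof (rule field_differentiable_bound[where S = ?S and f' = "\<lambda>s. g' s - g' x - g'' x * (s - x)"])
    fix s assume s: "s \<in> ?S"
    then have s': "s \<in> {a..b}" using S by blast
    have "(g has_real_derivative g' s) (at s within ?S)"
      using g[OF s'] S by (rule DERIV_subset)
    then show "((\<lambda>s. g s - g' x * (s - x) - 1/2 * g'' x * (s - x)\<^sup>2) has_real_derivative
        g' s - g' x - g'' x * (s - x)) (at s within ?S)"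
      by (auto intro!: derivative_eq_intros)
    have "norm (g' s - g' x - g'' x * (s - x)) \<le> K * (s - x)\<^sup>2"
      using taylor_first_order[OF g' g'' K x s'] by simp
    also have "\<dots> \<le> K * (z - x)\<^sup>2"
    proof (rule mult_left_mono[OF _ K0])
      have "\<bar>s - x\<bar> \<le> \<bar>z - x\<bar>" using s by auto
      then show "(s - x)\<^sup>2 \<le> (z - x)\<^sup>2" by (rule abs_le_square_iff[THEN iffD1])
    qed
    finally show "norm (g' s - g' x - g'' x * (s - x)) \<le> K * (z - x)\<^sup>2" .
  qed auto
  then show ?thesis by (simp add: power3_eq_cube power2_eq_square algebra_simps)
qed

text \<open>
  A displacement no longer than the interval is reflected at most once. In that case the wall \<open>c\<close> lies
  between the start and the unreflected end point, so the distances of both points to \<open>c\<close> are bounded by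
  the displacement. This is what lets remainders taken at the wall be measured by \<open>d\<close>.
\<close>

lemma reflect_cases:
  assumes "x \<in> {a..b}" "\<bar>d\<bar> \<le> b - a"
  obtains (inside) "reflect a b (x + d) = x + d" "x + d \<in> {a..b}"
  | (wall) c w where "c = a \<or> c = b" "reflect a b (x + d) = w" "w \<in> {a..b}" "x + d = 2 * c - w"
      "\<bar>w - c\<bar> \<le> \<bar>d\<bar>" "\<bar>x - c\<bar> \<le> \<bar>d\<bar>"
proof -
  consider "x + d < a" | "x + d > b" | "x + d \<in> {a..b}" by fastforce
  then show ?thesis
  proof cases
    case 1
    show ?thesis by (rule wall[of a "2 * a - (x + d)"]) (use 1 assms in \<open>auto simp: reflect_def\<close>)
  next
    case 2
    show ?thesis by (rule wall[of b "2 * b - (x + d)"]) (use 2 assms in \<open>auto simp: reflect_def\<close>)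
  next
    case 3
    then show ?thesis using inside by (auto simp: reflect_def)
  qed
qed

lemma reflect_in_interval:
  assumes "x \<in> {a..b}" "\<bar>d\<bar> \<le> b - a"
  shows "reflect a b (x + d) \<in> {a..b}"
  by (rule reflect_cases[OF assms]) auto

lemma reflect_displacement:
  assumes "x \<in> {a..b}" "\<bar>d\<bar> \<le> b - a"
  shows "\<bar>reflect a b (x + d) - x\<bar> \<le> \<bar>d\<bar>"
  using assms by (auto simp: reflect_def)

text \<open>
  Following a reflected path amounts to evaluating the even extension of \<open>g\<close> at the unreflected point. When
  \<open>g'\<close> vanishes at the walls, the extension still has a Lipschitz derivative, so the Taylor formula
  holds with the unreflected displacement \<open>d\<close>.
\<close>

lemma reflected_taylor_first_order:
  fixes g g' g'' :: "real \<Rightarrow> real"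
  assumes g: "\<And>z. z \<in> {a..b} \<Longrightarrow> (g has_real_derivative g' z) (at z within {a..b})"
    and g': "\<And>z. z \<in> {a..b} \<Longrightarrow> (g' has_real_derivative g'' z) (at z within {a..b})"
    and K: "\<And>z. z \<in> {a..b} \<Longrightarrow> \<bar>g'' z\<bar> \<le> K"
    and walls: "g' a = 0" "g' b = 0"
    and x: "x \<in> {a..b}" and d: "\<bar>d\<bar> \<le> b - a"
  shows "\<bar>g (reflect a b (x + d)) - g x - g' x * d\<bar> \<le> 3 * K * d\<^sup>2"
proof -
  have K0: "0 \<le> K" using K[OF x] by linarith
  from x d show ?thesis
  proof (cases rule: reflect_cases)
    case inside
    have "\<bar>g (x + d) - g x - g' x * d\<bar> \<le> K * d\<^sup>2" using taylor_first_order[OF g g' K x inside(2)] by simp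
    also have "\<dots> \<le> 3 * K * d\<^sup>2" using K0 by (simp add: mult_right_mono)
    finally show ?thesis using inside by simp
  next
    case (wall c w)
    have c: "c \<in> {a..b}" "g' c = 0" using wall(1) walls x by auto
    have sq: "u\<^sup>2 \<le> d\<^sup>2" if "\<bar>u\<bar> \<le> \<bar>d\<bar>" for u :: real
      using that by (rule abs_le_square_iff[THEN iffD1])
    have "\<bar>g w - g c\<bar> \<le> K * (w - c)\<^sup>2" using taylor_first_order[OF g g' K c(1) wall(3)] c(2) by simp
    also have "\<dots> \<le> K * d\<^sup>2" by (intro mult_left_mono sq K0 wall)
    finally have 1: "\<bar>g w - g c\<bar> \<le> K * d\<^sup>2" .
    have "\<bar>g x - g c\<bar> \<le> K * (x - c)\<^sup>2" using taylor_first_order[OF g g' K c(1) x] c(2) by simp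
    also have "\<dots> \<le> K * d\<^sup>2" by (intro mult_left_mono sq K0 wall)
    finally have 2: "\<bar>g x - g c\<bar> \<le> K * d\<^sup>2" .
    have "norm (g' x - g' c) \<le> K * norm (x - c)"
      by (rule field_differentiable_bound[OF _ g']) (use K c x in auto)
    also have "\<dots> \<le> K * \<bar>d\<bar>" using wall(6) K0 by (simp add: mult_left_mono)
    finally have "\<bar>g' x\<bar> \<le> K * \<bar>d\<bar>" using c by simp
    then have "\<bar>g' x\<bar> * \<bar>d\<bar> \<le> K * \<bar>d\<bar> * \<bar>d\<bar>" by (rule mult_right_mono) simp
    then have 3: "\<bar>g' x * d\<bar> \<le> K * d\<^sup>2" by (simp add: abs_mult power2_eq_square mult.assoc)
    show ?thesis unfolding wall(2) using 1 2 3 by linarith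
  qed
qed

text \<open>
  The even extension of a \<open>C\<^sup>3\<close> function with \<open>g' = 0\<close> at the walls has a Lipschitz second derivative
  (only its third derivative jumps), so reflection costs no order.
\<close>

lemma reflected_taylor_second_order:
  fixes g g' g'' g''' :: "real \<Rightarrow> real"
  assumes g: "\<And>z. z \<in> {a..b} \<Longrightarrow> (g has_real_derivative g' z) (at z within {a..b})"
    and g': "\<And>z. z \<in> {a..b} \<Longrightarrow> (g' has_real_derivative g'' z) (at z within {a..b})"
    and g'': "\<And>z. z \<in> {a..b} \<Longrightarrow> (g'' has_real_derivative g''' z) (at z within {a..b})"
    and K: "\<And>z. z \<in> {a..b} \<Longrightarrow> \<bar>g''' z\<bar> \<le> K"
    and walls: "g' a = 0" "g' b = 0"
    and x: "x \<in> {a..b}" and d: "\<bar>d\<bar> \<le> b - a"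
  shows "\<bar>g (reflect a b (x + d)) - g x - g' x * d - 1/2 * g'' x * d\<^sup>2\<bar> \<le> 4 * K * \<bar>d\<bar> ^ 3"
proof -
  have K0: "0 \<le> K" using K[OF x] by linarith
  have K3: "0 \<le> K * \<bar>d\<bar> ^ 3" using K0 by simp
  from x d show ?thesis
  proof (cases rule: reflect_cases)
    case inside
    show ?thesis using taylor_second_order[OF g g' g'' K x inside(2)] inside K3 by simp
  next
    case (wall c w)
    have c: "c \<in> {a..b}" "g' c = 0" using wall(1) walls x by auto
    \<comment> \<open>Both \<open>w\<close> and \<open>x\<close> are expanded about the wall. As \<open>g' c = 0\<close>, the expansion of \<open>g\<close> there is
        even, so it takes the same value at \<open>w\<close> and at its mirror image \<open>x + d\<close>, and the
        quadratic polynomials cancel.\<close>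
    define R where "R u = g u - g c - 1/2 * g'' c * (u - c)\<^sup>2" for u
    define R1 where "R1 = g' x - g'' c * (x - c)"
    define R2 where "R2 = g'' x - g'' c"
    have cube: "K * \<bar>u\<bar> ^ 3 \<le> K * \<bar>d\<bar> ^ 3" if "\<bar>u\<bar> \<le> \<bar>d\<bar>" for u :: real
      using that K0 by (intro mult_left_mono power_mono) auto
    have 1: "\<bar>R w\<bar> \<le> K * \<bar>d\<bar> ^ 3"
      using taylor_second_order[OF g g' g'' K c(1) wall(3)] c(2) cube[OF wall(5)] by (simp add: R_def)
    have 2: "\<bar>R x\<bar> \<le> K * \<bar>d\<bar> ^ 3"
      using taylor_second_order[OF g g' g'' K c(1) x] c(2) cube[OF wall(6)] by (simp add: R_def)
    have "\<bar>R1\<bar> \<le> K * (x - c)\<^sup>2"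
      using taylor_first_order[OF g' g'' K c(1) x] c(2) by (simp add: R1_def)
    also have "\<dots> \<le> K * d\<^sup>2"
      by (intro mult_left_mono abs_le_square_iff[THEN iffD1] K0 wall)
    finally have "\<bar>R1\<bar> * \<bar>d\<bar> \<le> K * d\<^sup>2 * \<bar>d\<bar>" by (rule mult_right_mono) simp
    then have 3: "\<bar>R1 * d\<bar> \<le> K * \<bar>d\<bar> ^ 3"
      by (simp add: abs_mult power3_eq_cube power2_eq_square mult.assoc)
    have "norm (g'' x - g'' c) \<le> K * norm (x - c)"
      by (rule field_differentiable_bound[OF _ g'']) (use K c x in auto)
    also have "\<dots> \<le> K * \<bar>d\<bar>" using wall(6) K0 by (simp add: mult_left_mono)
    finally have "\<bar>R2\<bar> * d\<^sup>2 \<le> K * \<bar>d\<bar> * d\<^sup>2" by (intro mult_right_mono) (auto simp: R2_def)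
    then have 4: "\<bar>R2 * d\<^sup>2\<bar> \<le> K * \<bar>d\<bar> ^ 3"
      by (simp add: abs_mult power3_eq_cube power2_eq_square mult.assoc)
    have dw: "d = 2 * c - w - x" using wall(4) by simp
    have "g w - g x - g' x * d - 1/2 * g'' x * d\<^sup>2 = R w - R x - R1 * d - 1/2 * (R2 * d\<^sup>2)"
      unfolding R_def R1_def R2_def dw by (simp add: power2_eq_square algebra_simps)
    moreover have "\<bar>R w - R x - R1 * d - 1/2 * (R2 * d\<^sup>2)\<bar> \<le> 4 * (K * \<bar>d\<bar> ^ 3)"
      using 1 2 3 4 K3 by linarith
    ultimately show ?thesis unfolding wall(2) by simp
  qed
qed

section \<open>Partial derivatives on a closed box\<close>

datatype axis = Dx | Dy | Dt

text \<open>
  A list of axes names the iterated partial derivative taken in the order of the list, so that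
  \<open>d [Dx, Dy]\<close> is \<open>f\<^sub>x\<^sub>y = (f\<^sub>x)\<^sub>y\<close>. Derivatives are one-sided on the faces of the box.
\<close>

definition derivative_family ::
  "real set \<Rightarrow> real set \<Rightarrow> real set \<Rightarrow> nat \<Rightarrow> (axis list \<Rightarrow> field) \<Rightarrow> bool" where
  "derivative_family X Y I k d \<longleftrightarrow>
     (\<forall>w. length w < k \<longrightarrow> (\<forall>x\<in>X. \<forall>y\<in>Y. \<forall>t\<in>I.
        ((\<lambda>s. d w s y t) has_real_derivative d (w @ [Dx]) x y t) (at x within X) \<and>
        ((\<lambda>s. d w x s t) has_real_derivative d (w @ [Dy]) x y t) (at y within Y) \<and>
        ((\<lambda>s. d w x y s) has_real_derivative d (w @ [Dt]) x y t) (at t within I))) \<and>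
     (\<forall>w. length w \<le> k \<longrightarrow> continuous_on (X \<times> Y \<times> I) (\<lambda>(x, y, t). d w x y t))"

lemma has_derivative_along_line:
  fixes F :: "'a::euclidean_space \<Rightarrow> real" and l :: "real \<Rightarrow> 'a"
  assumes "(F has_derivative (\<lambda>v. g \<bullet> v)) (at (l x) within S)"
    and "(l has_vector_derivative e) (at x within X)" and "l ` X \<subseteq> S"
  shows "((\<lambda>s. F (l s)) has_real_derivative g \<bullet> e) (at x within X)"
proof -
  have "((\<lambda>s. F (l s)) has_derivative (\<lambda>h. g \<bullet> (h *\<^sub>R e))) (at x within X)"
    using has_derivative_in_compose[OF assms(2)[unfolded has_vector_derivative_def]
        has_derivative_subset[OF assms(1,3)]] .
  then show ?thesis
    by (simp add: has_field_derivative_def mult.commute[of "g \<bullet> e"] fun_eq_iff mult_commute_abs)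
qed

lemma Ck_on_imp_continuous_on: "Ck_on k F S \<Longrightarrow> continuous_on S F"
  by (cases k) (auto intro: has_derivative_continuous_on)

text \<open>
  Passing from gradients to families: the gradient components along the three axes carry families of their
  own by induction, and prefixing the axis glues the three together.
\<close>

lemma Ck_on_derivative_family:
  assumes "Ck_on k (\<lambda>(x, y, t). F x y t) (X \<times> Y \<times> I)"
  shows "\<exists>d. d [] = F \<and> derivative_family X Y I k d"
  using assms
proof (induction k arbitrary: F)
  case 0
  show ?case
    by (rule exI[of _ "\<lambda>w. F"]) (use 0 in \<open>simp add: derivative_family_def\<close>)
next
  case (Suc k)
  let ?S = "X \<times> Y \<times> I"
  obtain g where g: "\<And>p. p \<in> ?S \<Longrightarrow>
        ((\<lambda>(x, y, t). F x y t) has_derivative (\<lambda>v. g p \<bullet> v)) (at p within ?S)"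
    and Ck: "\<And>e. e \<in> Basis \<Longrightarrow> Ck_on k (\<lambda>p. g p \<bullet> e) ?S"
    using Suc.prems unfolding Ck_on.simps by blast
  define G where "G e x y t = g (x, y, t) \<bullet> e" for e x y t
  have "Ck_on k (\<lambda>(x, y, t). G e x y t) ?S" if "e \<in> Basis" for e
    using Ck[OF that] by (simp add: G_def case_prod_unfold)
  then have ex: "\<exists>d. d [] = G e \<and> derivative_family X Y I k d" if "e \<in> Basis" for e
    using Suc.IH that by blast
  have "(1, 0, 0) \<in> (Basis :: (real \<times> real \<times> real) set)"
    "(0, 1, 0) \<in> (Basis :: (real \<times> real \<times> real) set)"
    "(0, 0, 1) \<in> (Basis :: (real \<times> real \<times> real) set)"
    by (auto simp: Basis_prod_def zero_prod_def)
  then obtain dx dy dt where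
      dx: "dx [] = G (1, 0, 0)" "derivative_family X Y I k dx" and
      dy: "dy [] = G (0, 1, 0)" "derivative_family X Y I k dy" and
      dt: "dt [] = G (0, 0, 1)" "derivative_family X Y I k dt"
    using ex by metis
  define d where "d w = (case w of [] \<Rightarrow> F | Dx # v \<Rightarrow> dx v | Dy # v \<Rightarrow> dy v | Dt # v \<Rightarrow> dt v)" for w
  have "((\<lambda>s. F s y t) has_real_derivative G (1, 0, 0) x y t) (at x within X)"
    "((\<lambda>s. F x s t) has_real_derivative G (0, 1, 0) x y t) (at y within Y)"
    "((\<lambda>s. F x y s) has_real_derivative G (0, 0, 1) x y t) (at t within I)"
    if "x \<in> X" "y \<in> Y" "t \<in> I" for x y t
    using that
    by (auto simp: G_def zero_prod_def intro!:
        has_derivative_along_line[where F = "\<lambda>(x, y, t). F x y t" and l = "\<lambda>s. (s, y, t)", simplified, OF g]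
        has_derivative_along_line[where F = "\<lambda>(x, y, t). F x y t" and l = "\<lambda>s. (x, s, t)", simplified, OF g]
        has_derivative_along_line[where F = "\<lambda>(x, y, t). F x y t" and l = "\<lambda>s. (x, y, s)", simplified, OF g]
        derivative_eq_intros has_vector_derivative_Pair has_vector_derivative_const has_vector_derivative_id)
  then have "derivative_family X Y I (Suc k) d"
    using dx dy dt Ck_on_imp_continuous_on[OF Suc.prems]
    unfolding derivative_family_def d_def
    by (auto split: list.split axis.split)
  then show ?case by (intro exI[of _ d]) (auto simp: d_def[of "[]"])
qed

text \<open>
  One constant serves for all derivatives because there are only finitely many lists of axes of length at
  most \<open>k\<close>.
\<close>

lemma derivative_family_bounded:
  assumes "derivative_family X Y I k d" "compact X" "compact Y" "compact I"
  obtains K where "\<And>w x y t. length w \<le> k \<Longrightarrow> x \<in> X \<Longrightarrow> y \<in> Y \<Longrightarrow> t \<in> I \<Longrightarrow> \<bar>d w x y t\<bar> \<le> K"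
proof -
  let ?S = "X \<times> Y \<times> I"
  let ?W = "{w :: axis list. length w \<le> k}"
  have S: "compact ?S" using assms by (intro compact_Times)
  have "\<forall>w\<in>?W. \<exists>C>0. \<forall>p\<in>?S. \<bar>(\<lambda>(x, y, t). d w x y t) p\<bar> \<le> C"
  proof
    fix w assume "w \<in> ?W"
    then have "continuous_on ?S (\<lambda>(x, y, t). d w x y t)"
      using assms(1) unfolding derivative_family_def by blast
    then have "bounded ((\<lambda>(x, y, t). d w x y t) ` ?S)"
      by (intro compact_imp_bounded compact_continuous_image S)
    then show "\<exists>C>0. \<forall>p\<in>?S. \<bar>(\<lambda>(x, y, t). d w x y t) p\<bar> \<le> C"
      unfolding bounded_pos by (simp only: ball_simps real_norm_def)
  qed
  then obtain C where C: "\<And>w. w \<in> ?W \<Longrightarrow> C w > 0 \<and> (\<forall>p\<in>?S. \<bar>(\<lambda>(x, y, t). d w x y t) p\<bar> \<le> C w)"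
    by metis
  have "(UNIV :: axis set) = {Dx, Dy, Dt}" by (auto intro: axis.exhaust)
  then have "finite (UNIV :: axis set)" by (metis finite.emptyI finite.insertI)
  then have W: "finite ?W" using finite_lists_length_le[of "UNIV :: axis set" k] by simp
  have "\<bar>d w x y t\<bar> \<le> sum C ?W" if "length w \<le> k" "x \<in> X" "y \<in> Y" "t \<in> I" for w x y t
  proof -
    have "\<bar>(\<lambda>(x, y, t). d w x y t) (x, y, t)\<bar> \<le> C w" using C[of w] that by blast
    also have "C w \<le> sum C ?W"
      using C that(1) W by (intro member_le_sum) (auto intro: less_imp_le)
    finally show ?thesis by simp
  qed
  then show ?thesis by (rule that)
qed

text \<open>
  Two applications of the mean value theorem, first in \<open>x\<close> and then in \<open>y\<close>. The left-hand side is symmetric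
  in the two variables, so the same lemma with the variables exchanged produces the other mixed derivative.
\<close>

lemma mixed_difference_mean_value:
  fixes F Fx Fxy :: "real \<Rightarrow> real \<Rightarrow> real"
  assumes "x1 < x2" "y1 < y2"
    and Fx: "\<And>x y. x \<in> {x1..x2} \<Longrightarrow> y \<in> {y1..y2} \<Longrightarrow>
          ((\<lambda>s. F s y) has_real_derivative Fx x y) (at x within {x1..x2})"
    and Fxy: "\<And>x y. x \<in> {x1..x2} \<Longrightarrow> y \<in> {y1..y2} \<Longrightarrow>
          (Fx x has_real_derivative Fxy x y) (at y within {y1..y2})"
  shows "\<exists>\<xi>\<in>{x1..x2}. \<exists>\<eta>\<in>{y1..y2}.
     F x2 y2 - F x2 y1 - F x1 y2 + F x1 y1 = (x2 - x1) * (y2 - y1) * Fxy \<xi> \<eta>"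
proof -
  have "\<exists>\<xi>\<in>{x1<..<x2}. (F x2 y2 - F x2 y1) - (F x1 y2 - F x1 y1)
      = (Fx \<xi> y2 - Fx \<xi> y1) * (x2 - x1)"
    by (rule mvt_simple[OF assms(1), where f = "\<lambda>s. F s y2 - F s y1"
          and f' = "\<lambda>x h. (Fx x y2 - Fx x y1) * h"])
       (use assms(2) in \<open>auto intro!: Fx DERIV_diff has_field_derivative_imp_has_derivative\<close>)
  then obtain \<xi> where "\<xi> \<in> {x1<..<x2}" and
    \<xi>_eq: "(F x2 y2 - F x2 y1) - (F x1 y2 - F x1 y1) = (Fx \<xi> y2 - Fx \<xi> y1) * (x2 - x1)"
    by blast
  then have \<xi>: "\<xi> \<in> {x1..x2}" by simp
  have "\<exists>\<eta>\<in>{y1<..<y2}. Fx \<xi> y2 - Fx \<xi> y1 = Fxy \<xi> \<eta> * (y2 - y1)"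
    by (rule mvt_simple[OF assms(2), where f' = "\<lambda>y h. Fxy \<xi> y * h"])
       (use \<xi> in \<open>auto intro!: Fxy has_field_derivative_imp_has_derivative\<close>)
  then obtain \<eta> where \<eta>: "\<eta> \<in> {y1<..<y2}" and \<eta>_eq: "Fx \<xi> y2 - Fx \<xi> y1 = Fxy \<xi> \<eta> * (y2 - y1)"
    by blast
  have "F x2 y2 - F x2 y1 - F x1 y2 + F x1 y1 = (Fx \<xi> y2 - Fx \<xi> y1) * (x2 - x1)"
    using \<xi>_eq by linarith
  also have "\<dots> = (x2 - x1) * (y2 - y1) * Fxy \<xi> \<eta>"
    unfolding \<eta>_eq by simp
  finally show ?thesis using \<xi> \<eta> by (meson greaterThanLessThan_subseteq_atLeastAtMost_iff order_refl subsetD)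
qed

lemma interval_nearby:
  fixes a b x \<delta> :: real
  assumes "a < b" "x \<in> {a..b}" "\<delta> > 0"
  obtains x1 x2 where "x1 < x2" "{x1..x2} \<subseteq> {a..b}" "\<forall>s\<in>{x1..x2}. \<bar>s - x\<bar> \<le> \<delta>"
proof (rule that[of "max a (x - \<delta>)" "min b (x + \<delta>)"])
qed (use assms in auto)

text \<open>
  The symmetry is needed up to the boundary of the rectangle, with one-sided derivatives. The usual
  argument by mixed differences still works: near any point of the closed rectangle there are small
  rectangles inside it.
\<close>

lemma mixed_partials_commute:
  fixes F Fx Fy Fxy Fyx :: "real \<Rightarrow> real \<Rightarrow> real"
  assumes ab: "a < b" and ce: "c < e"
    and Fx: "\<And>x y. x \<in> {a..b} \<Longrightarrow> y \<in> {c..e} \<Longrightarrow>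
          ((\<lambda>s. F s y) has_real_derivative Fx x y) (at x within {a..b})"
    and Fy: "\<And>x y. x \<in> {a..b} \<Longrightarrow> y \<in> {c..e} \<Longrightarrow>
          (F x has_real_derivative Fy x y) (at y within {c..e})"
    and Fxy: "\<And>x y. x \<in> {a..b} \<Longrightarrow> y \<in> {c..e} \<Longrightarrow>
          (Fx x has_real_derivative Fxy x y) (at y within {c..e})"
    and Fyx: "\<And>x y. x \<in> {a..b} \<Longrightarrow> y \<in> {c..e} \<Longrightarrow>
          ((\<lambda>s. Fy s y) has_real_derivative Fyx x y) (at x within {a..b})"
    and cont: "continuous_on ({a..b} \<times> {c..e}) (\<lambda>(x, y). Fxy x y)"
      "continuous_on ({a..b} \<times> {c..e}) (\<lambda>(x, y). Fyx x y)"
    and x: "x \<in> {a..b}" and y: "y \<in> {c..e}"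
  shows "Fxy x y = Fyx x y"
proof -
  have "\<bar>Fxy x y - Fyx x y\<bar> \<le> \<epsilon>" if "\<epsilon> > 0" for \<epsilon>
  proof -
    have near: "\<exists>\<delta>>0. \<forall>x'\<in>{a..b}. \<forall>y'\<in>{c..e}. \<bar>x' - x\<bar> \<le> \<delta> \<longrightarrow> \<bar>y' - y\<bar> \<le> \<delta> \<longrightarrow> \<bar>H x' y' - H x y\<bar> < \<epsilon>/2"
      if H: "continuous_on ({a..b} \<times> {c..e}) (\<lambda>(x, y). H x y)" for H :: "real \<Rightarrow> real \<Rightarrow> real"
    proof -
      have "(x, y) \<in> {a..b} \<times> {c..e}" "\<epsilon>/2 > 0" using x y \<open>\<epsilon> > 0\<close> by auto
      then obtain \<delta> where \<delta>: "\<delta> > 0" "\<forall>p\<in>{a..b} \<times> {c..e}. dist p (x, y) < \<delta> \<longrightarrow>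
          dist ((\<lambda>(x, y). H x y) p) ((\<lambda>(x, y). H x y) (x, y)) < \<epsilon>/2"
        using H unfolding continuous_on_iff by meson
      have "\<bar>H x' y' - H x y\<bar> < \<epsilon>/2"
        if p: "x' \<in> {a..b}" "y' \<in> {c..e}" "\<bar>x' - x\<bar> \<le> \<delta>/3" "\<bar>y' - y\<bar> \<le> \<delta>/3" for x' y'
      proof -
        have "dist (x', y') (x, y) \<le> \<bar>x' - x\<bar> + \<bar>y' - y\<bar>"
          using sqrt_sum_squares_le_sum_abs by (simp add: dist_prod_def dist_real_def)
        also have "\<dots> < \<delta>" using p \<delta>(1) by linarith
        finally show ?thesis using bspec[OF \<delta>(2), of "(x', y')"] p by (simp add: dist_real_def)
      qed
      then show ?thesis using \<delta>(1) by (intro exI[of _ "\<delta>/3"]) auto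
    qed
    obtain \<delta>1 \<delta>2 where pos: "\<delta>1 > 0" "\<delta>2 > 0" and
      \<delta>1: "\<And>x' y'. x'\<in>{a..b} \<Longrightarrow> y'\<in>{c..e} \<Longrightarrow> \<bar>x' - x\<bar> \<le> \<delta>1 \<Longrightarrow> \<bar>y' - y\<bar> \<le> \<delta>1 \<Longrightarrow> \<bar>Fxy x' y' - Fxy x y\<bar> < \<epsilon>/2" and
      \<delta>2: "\<And>x' y'. x'\<in>{a..b} \<Longrightarrow> y'\<in>{c..e} \<Longrightarrow> \<bar>x' - x\<bar> \<le> \<delta>2 \<Longrightarrow> \<bar>y' - y\<bar> \<le> \<delta>2 \<Longrightarrow> \<bar>Fyx x' y' - Fyx x y\<bar> < \<epsilon>/2"
      using near[OF cont(1)] near[OF cont(2)] by blast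
    have \<delta>: "min \<delta>1 \<delta>2 > 0" using pos by simp
    obtain x1 x2 where X: "x1 < x2" "{x1..x2} \<subseteq> {a..b}" "\<forall>s\<in>{x1..x2}. \<bar>s - x\<bar> \<le> min \<delta>1 \<delta>2"
      using interval_nearby[OF ab x \<delta>] by metis
    obtain y1 y2 where Y: "y1 < y2" "{y1..y2} \<subseteq> {c..e}" "\<forall>s\<in>{y1..y2}. \<bar>s - y\<bar> \<le> min \<delta>1 \<delta>2"
      using interval_nearby[OF ce y \<delta>] by metis
    have "\<exists>\<xi>\<in>{x1..x2}. \<exists>\<eta>\<in>{y1..y2}.
        F x2 y2 - F x2 y1 - F x1 y2 + F x1 y1 = (x2 - x1) * (y2 - y1) * Fxy \<xi> \<eta>"
      by (rule mixed_difference_mean_value[OF X(1) Y(1), of F Fx Fxy])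
         (use X(2) Y(2) in \<open>auto intro: DERIV_subset[OF Fx] DERIV_subset[OF Fxy]\<close>)
    then obtain \<xi> \<eta> where 1: "\<xi> \<in> {x1..x2}" "\<eta> \<in> {y1..y2}"
      "F x2 y2 - F x2 y1 - F x1 y2 + F x1 y1 = (x2 - x1) * (y2 - y1) * Fxy \<xi> \<eta>" by blast
    have "\<exists>\<eta>\<in>{y1..y2}. \<exists>\<xi>\<in>{x1..x2}.
        F x2 y2 - F x1 y2 - F x2 y1 + F x1 y1 = (y2 - y1) * (x2 - x1) * Fyx \<xi> \<eta>"
      by (rule mixed_difference_mean_value[OF Y(1) X(1), of "\<lambda>y x. F x y" "\<lambda>y x. Fy x y" "\<lambda>y x. Fyx x y"])
         (use X(2) Y(2) in \<open>auto intro: DERIV_subset[OF Fy] DERIV_subset[OF Fyx]\<close>)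
    then obtain \<xi>' \<eta>' where 2: "\<xi>' \<in> {x1..x2}" "\<eta>' \<in> {y1..y2}"
      "F x2 y2 - F x1 y2 - F x2 y1 + F x1 y1 = (y2 - y1) * (x2 - x1) * Fyx \<xi>' \<eta>'" by blast
    \<comment> \<open>The same mixed difference, computed in the two orders.\<close>
    have "(x2 - x1) * (y2 - y1) * Fxy \<xi> \<eta> = (x2 - x1) * (y2 - y1) * Fyx \<xi>' \<eta>'"
      using 1(3) 2(3) by (simp add: algebra_simps)
    then have eq: "Fxy \<xi> \<eta> = Fyx \<xi>' \<eta>'" using X(1) Y(1) by simp
    have "\<bar>Fxy \<xi> \<eta> - Fxy x y\<bar> < \<epsilon>/2"
      using X(2) Y(2) bspec[OF X(3) 1(1)] bspec[OF Y(3) 1(2)] 1 by (intro \<delta>1) auto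
    moreover have "\<bar>Fyx \<xi>' \<eta>' - Fyx x y\<bar> < \<epsilon>/2"
      using X(2) Y(2) bspec[OF X(3) 2(1)] bspec[OF Y(3) 2(2)] 2 by (intro \<delta>2) auto
    ultimately show ?thesis using eq by linarith
  qed
  then have "\<bar>Fxy x y - Fyx x y\<bar> \<le> 0" by (rule field_le_epsilon) simp
  then show ?thesis by simp
qed

section \<open>Fields with homogeneous Neumann data\<close>

lemma at_within_Icc_nontrivial: "a < b \<Longrightarrow> x \<in> {a..b} \<Longrightarrow> at x within {a..b} \<noteq> bot" for x :: real
  by (simp add: trivial_limit_within islimpt_Icc)

lemma derivative_within_Icc_unique:
  fixes g :: "real \<Rightarrow> real"
  assumes "a < b" "x \<in> {a..b}"
    and "(g has_real_derivative D) (at x within {a..b})" "(g has_real_derivative E) (at x within {a..b})"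
  shows "D = E"
  using has_field_derivative_unique[OF assms(3,4)] at_within_Icc_nontrivial[OF assms(1,2)] by blast

lemma zero_on_closed_rectangle:
  fixes g :: "real \<Rightarrow> real \<Rightarrow> real"
  assumes "a < b" "c < e" "continuous_on ({a..b} \<times> {c..e}) (\<lambda>(x, y). g x y)"
    and zero: "\<And>x y. x \<in> {a<..<b} \<Longrightarrow> y \<in> {c<..<e} \<Longrightarrow> g x y = 0"
    and "x \<in> {a..b}" "y \<in> {c..e}"
  shows "g x y = 0"
proof -
  have cl: "closure ({a<..<b} \<times> {c<..<e}) = {a..b} \<times> {c..e}"
    using assms by (simp add: closure_Times)
  have "(\<lambda>(x, y). g x y) (x, y) = 0"
    by (rule continuous_constant_on_closure[where S = "{a<..<b} \<times> {c<..<e}"])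
       (use assms cl in auto)
  then show ?thesis by simp
qed

text \<open>
  The boundary condition is imposed on open edges and before the terminal time. The derivative is continuous on
  the closed box, so the condition persists at the corners and at time \<open>T\<close>, where the first step of the
  scheme reads the solution.
\<close>

lemma homogeneous_neumann_closed:
  assumes box: "xL < xR" "yL < yR" "0 < T"
    and family: "derivative_family {xL..xR} {yL..yR} {0..T} k d" "1 \<le> k"
    and neumann: "homogeneous_neumann xL xR yL yR T (d [])"
  shows "x \<in> {xL, xR} \<Longrightarrow> y \<in> {yL..yR} \<Longrightarrow> t \<in> {0..T} \<Longrightarrow> d [Dx] x y t = 0"
    and "x \<in> {xL..xR} \<Longrightarrow> y \<in> {yL, yR} \<Longrightarrow> t \<in> {0..T} \<Longrightarrow> d [Dy] x y t = 0"
proof -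
  have cont: "continuous_on ({xL..xR} \<times> {yL..yR} \<times> {0..T}) (\<lambda>(x, y, t). d [e] x y t)" for e
    using family unfolding derivative_family_def by simp
  have deriv: "((\<lambda>s. d [] s y t) has_real_derivative d [Dx] x y t) (at x within {xL..xR})"
    "((\<lambda>s. d [] x s t) has_real_derivative d [Dy] x y t) (at y within {yL..yR})"
    if "x \<in> {xL..xR}" "y \<in> {yL..yR}" "t \<in> {0..T}" for x y t
    using family(1)[unfolded derivative_family_def, THEN conjunct1, rule_format, of "[]" x y t]
      family(2) that by simp_all
  show "d [Dx] x y t = 0" if x: "x \<in> {xL, xR}" and y: "y \<in> {yL..yR}" and t: "t \<in> {0..T}"
  proof (rule zero_on_closed_rectangle[OF box(2,3) _ _ y t])
    have x': "x \<in> {xL..xR}" using x box by auto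
    have "continuous_on ({yL..yR} \<times> {0..T}) (\<lambda>p. (x, fst p, snd p))"
      by (intro continuous_intros)
    then have "continuous_on ({yL..yR} \<times> {0..T}) (\<lambda>p. (\<lambda>(x, y, t). d [Dx] x y t) (x, fst p, snd p))"
      by (rule continuous_on_compose2[OF cont]) (use x' in auto)
    then show "continuous_on ({yL..yR} \<times> {0..T}) (\<lambda>(y, t). d [Dx] x y t)"
      by (simp add: case_prod_unfold)
    show "d [Dx] x y t = 0" if "y \<in> {yL<..<yR}" "t \<in> {0<..<T}" for y t
    proof (rule derivative_within_Icc_unique[OF box(1) x'])
      show "((\<lambda>s. d [] s y t) has_real_derivative 0) (at x within {xL..xR})"
        using neumann that x unfolding homogeneous_neumann_def by auto
    qed (use deriv(1)[OF x'] that in auto)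
  qed
  show "d [Dy] x y t = 0" if x: "x \<in> {xL..xR}" and y: "y \<in> {yL, yR}" and t: "t \<in> {0..T}"
  proof (rule zero_on_closed_rectangle[OF box(1,3) _ _ x t])
    have y': "y \<in> {yL..yR}" using y box by auto
    have "continuous_on ({xL..xR} \<times> {0..T}) (\<lambda>p. (fst p, y, snd p))"
      by (intro continuous_intros)
    then have "continuous_on ({xL..xR} \<times> {0..T}) (\<lambda>p. (\<lambda>(x, y, t). d [Dy] x y t) (fst p, y, snd p))"
      by (rule continuous_on_compose2[OF cont]) (use y' in auto)
    then show "continuous_on ({xL..xR} \<times> {0..T}) (\<lambda>(x, t). d [Dy] x y t)"
      by (simp add: case_prod_unfold)
    show "d [Dy] x y t = 0" if "x \<in> {xL<..<xR}" "t \<in> {0<..<T}" for x t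
    proof (rule derivative_within_Icc_unique[OF box(2) y'])
      show "((\<lambda>s. d [] x s t) has_real_derivative 0) (at y within {yL..yR})"
        using neumann that y unfolding homogeneous_neumann_def by auto
    qed (use deriv(2)[OF _ y'] that in auto)
  qed
qed

text \<open>
  The regularity and boundary data of the exact solution, with one bound \<open>K\<close> for all derivatives up to
  order three; the solution itself is \<open>d []\<close>.
\<close>

locale neumann_field =
  fixes xL xR yL yR T K :: real and d :: "axis list \<Rightarrow> field"
  assumes box: "xL < xR" "yL < yR" "0 < T"
    and family: "derivative_family {xL..xR} {yL..yR} {0..T} 3 d"
    and bound: "\<And>w x y t. length w \<le> 3 \<Longrightarrow> x \<in> {xL..xR} \<Longrightarrow> y \<in> {yL..yR} \<Longrightarrow> t \<in> {0..T} \<Longrightarrow>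
          \<bar>d w x y t\<bar> \<le> K"
    and wall_x: "\<And>x y t. x \<in> {xL, xR} \<Longrightarrow> y \<in> {yL..yR} \<Longrightarrow> t \<in> {0..T} \<Longrightarrow> d [Dx] x y t = 0"
    and wall_y: "\<And>x y t. x \<in> {xL..xR} \<Longrightarrow> y \<in> {yL, yR} \<Longrightarrow> t \<in> {0..T} \<Longrightarrow> d [Dy] x y t = 0"

begin

lemma K_nonneg: "0 \<le> K"
  using bound[of "[]" xL yL 0] box by fastforce

lemma
  assumes "length w < 3" "x \<in> {xL..xR}" "y \<in> {yL..yR}" "t \<in> {0..T}"
  shows deriv_x: "((\<lambda>s. d w s y t) has_real_derivative d (w @ [Dx]) x y t) (at x within {xL..xR})"
    and deriv_y: "((\<lambda>s. d w x s t) has_real_derivative d (w @ [Dy]) x y t) (at y within {yL..yR})"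
    and deriv_t: "((\<lambda>s. d w x y s) has_real_derivative d (w @ [Dt]) x y t) (at t within {0..T})"
  using family assms unfolding derivative_family_def by blast+

lemma continuous_family: "length w \<le> 3 \<Longrightarrow> continuous_on ({xL..xR} \<times> {yL..yR} \<times> {0..T}) (\<lambda>(x, y, t). d w x y t)"
  using family unfolding derivative_family_def by blast

lemma
  assumes "length w < 3" "x \<in> {xL..xR}" "x' \<in> {xL..xR}" "y \<in> {yL..yR}" "y' \<in> {yL..yR}"
    "t \<in> {0..T}"
  shows lipschitz_x: "\<bar>d w x' y t - d w x y t\<bar> \<le> K * \<bar>x' - x\<bar>"
    and lipschitz_y: "\<bar>d w x y' t - d w x y t\<bar> \<le> K * \<bar>y' - y\<bar>"
proof -
  have "norm (d w x' y t - d w x y t) \<le> K * norm (x' - x)"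
    by (rule field_differentiable_bound[OF _ deriv_x]) (use assms bound in auto)
  then show "\<bar>d w x' y t - d w x y t\<bar> \<le> K * \<bar>x' - x\<bar>" by simp
  have "norm (d w x y' t - d w x y t) \<le> K * norm (y' - y)"
    by (rule field_differentiable_bound[OF _ deriv_y]) (use assms bound in auto)
  then show "\<bar>d w x y' t - d w x y t\<bar> \<le> K * \<bar>y' - y\<bar>" by simp
qed

lemma mixed_commute:
  assumes "x \<in> {xL..xR}" "y \<in> {yL..yR}" "t \<in> {0..T}"
  shows "d [Dx, Dy] x y t = d [Dy, Dx] x y t"
proof -
  have slice: "continuous_on ({xL..xR} \<times> {yL..yR}) (\<lambda>(x, y). d w x y t)" if "length w \<le> 3" for w
  proof -
    have "continuous_on ({xL..xR} \<times> {yL..yR}) (\<lambda>p. (fst p, snd p, t))"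
      by (intro continuous_intros)
    then have "continuous_on ({xL..xR} \<times> {yL..yR}) (\<lambda>p. (\<lambda>(x, y, t). d w x y t) (fst p, snd p, t))"
      by (rule continuous_on_compose2[OF continuous_family[OF that]]) (use assms(3) in auto)
    then show ?thesis by (simp add: case_prod_unfold)
  qed
  have
    "((\<lambda>s. d [] s y t) has_real_derivative d [Dx] x y t) (at x within {xL..xR})"
    "((\<lambda>s. d [] x s t) has_real_derivative d [Dy] x y t) (at y within {yL..yR})"
    "((\<lambda>s. d [Dx] x s t) has_real_derivative d [Dx, Dy] x y t) (at y within {yL..yR})"
    "((\<lambda>s. d [Dy] s y t) has_real_derivative d [Dy, Dx] x y t) (at x within {xL..xR})"
    if "x \<in> {xL..xR}" "y \<in> {yL..yR}" for x y
    using deriv_x[of "[]" x y t] deriv_y[of "[]" x y t] deriv_x[of "[Dy]" x y t] deriv_y[of "[Dx]" x y t]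
      that assms(3) by simp_all
  note partials = this
  show ?thesis
    by (rule mixed_partials_commute[where F = "\<lambda>x y. d [] x y t" and Fx = "\<lambda>x y. d [Dx] x y t"
          and Fy = "\<lambda>x y. d [Dy] x y t" and Fxy = "\<lambda>x y. d [Dx, Dy] x y t"
          and Fyx = "\<lambda>x y. d [Dy, Dx] x y t", OF box(1,2) partials slice slice assms(1,2)])
       simp_all
qed

text \<open>
  Along a horizontal wall \<open>f\<^sub>y\<close> vanishes identically, hence so does \<open>f\<^sub>y\<^sub>x\<close>, which equals \<open>f\<^sub>x\<^sub>y\<close>.
\<close>

lemma wall_xy:
  assumes "x \<in> {xL..xR}" "y \<in> {yL, yR}" "t \<in> {0..T}"
  shows "d [Dx, Dy] x y t = 0"
proof -
  have y: "y \<in> {yL..yR}" using assms(2) box by auto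
  have "((\<lambda>s. d [Dy] s y t) has_real_derivative 0) (at x within {xL..xR})"
    by (rule has_field_derivative_transform_within[of "\<lambda>s. 0", OF _ zero_less_one assms(1)])
       (use wall_y assms in auto)
  then have "d [Dy, Dx] x y t = 0"
    using derivative_within_Icc_unique[OF box(1) assms(1)] deriv_x[of "[Dy]", OF _ assms(1) y assms(3)]
    by auto
  then show ?thesis using mixed_commute[OF assms(1) y assms(3)] by simp
qed

text \<open>
  The equation is stated with two-sided derivatives; at interior points these are members of the family,
  and the symmetry of mixed derivatives fixes the order of \<open>\<partial>\<^sub>x\<close> and \<open>\<partial>\<^sub>y\<close>.
\<close>

lemma satisfies_pde_family:
  assumes "satisfies_pde xL xR yL yR T \<rho> \<sigma>1 \<sigma>2 r b1 b2 (d [])"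
    and x: "x \<in> {xL<..<xR}" and y: "y \<in> {yL<..<yR}" and t: "t \<in> {0..<T}"
  shows "d [Dt] x y t + 1/2 * (\<sigma>1 x y t)\<^sup>2 * d [Dx, Dx] x y t
       + \<rho> x y t * \<sigma>1 x y t * \<sigma>2 x y t * d [Dx, Dy] x y t
       + 1/2 * (\<sigma>2 x y t)\<^sup>2 * d [Dy, Dy] x y t
       + b1 x y t * d [Dx] x y t + b2 x y t * d [Dy] x y t = r x y t * d [] x y t"
proof -
  have t': "t \<in> {0..T}" using t by simp
  have px: "partial_x (d w) x y t = d (w @ [Dx]) x y t"
    if "length w < 3" "x \<in> {xL<..<xR}" "y \<in> {yL<..<yR}" for w x y
    using deriv_x[OF that(1) _ _ t', of x y] that at_within_Icc_at[of xL x xR]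
    unfolding partial_x_def by (intro DERIV_imp_deriv) auto
  have py: "partial_y (d w) x y t = d (w @ [Dy]) x y t"
    if "length w < 3" "x \<in> {xL<..<xR}" "y \<in> {yL<..<yR}" for w x y
    using deriv_y[OF that(1) _ _ t', of x y] that at_within_Icc_at[of yL y yR]
    unfolding partial_y_def by (intro DERIV_imp_deriv) auto
  have deriv_eq: "deriv g z = deriv g' z" if "\<And>s. s \<in> {a<..<b} \<Longrightarrow> g s = g' s" "z \<in> {a<..<b}"
    for g g' :: "real \<Rightarrow> real" and z a b
    using that by (intro deriv_cong_ev eventually_mono[OF eventually_nhds_in_open[of "{a<..<b}" z]]) auto
  have "partial_x (partial_x (d [])) x y t = partial_x (d [Dx]) x y t"
    unfolding partial_x_def[of "partial_x (d [])"] partial_x_def[of "d [Dx]"]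
    by (rule deriv_eq[OF _ x]) (use px[of "[]"] y in simp)
  moreover have "partial_x (partial_y (d [])) x y t = partial_x (d [Dy]) x y t"
    unfolding partial_x_def[of "partial_y (d [])"] partial_x_def[of "d [Dy]"]
    by (rule deriv_eq[OF _ x]) (use py[of "[]"] y in simp)
  moreover have "partial_y (partial_y (d [])) x y t = partial_y (d [Dy]) x y t"
    unfolding partial_y_def[of "partial_y (d [])"] partial_y_def[of "d [Dy]"]
    by (rule deriv_eq[OF _ y]) (use py[of "[]"] x in simp)
  moreover have "partial_t T (d []) x y t = d [Dt] x y t"
    unfolding partial_t_def
    using deriv_t[of "[]" x y t] x y t' box(3)
    by (intro vector_derivative_within_cbox[where a = 0 and b = T, simplified])
       (auto simp: has_real_derivative_iff_has_vector_derivative)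
  moreover have "d [Dx, Dy] x y t = d [Dy, Dx] x y t" using mixed_commute x y t' by simp
  ultimately show ?thesis
    using assms(1) x y t px[of "[]" x y] px[of "[Dx]" x y] px[of "[Dy]" x y] py[of "[]" x y] py[of "[Dy]" x y]
    unfolding satisfies_pde_def by fastforce
qed

text \<open>
  Following a branch with reflection in both directions obeys the Taylor formula of the unreflected
  displacement, as if the solution were smooth across the walls. The scale \<open>s\<close> is of order \<open>\<surd>\<tau>\<close>: terms
  of order \<open>\<tau> s\<close> and \<open>\<tau>\<^sup>2\<close> count as third order.
\<close>

lemma reflected_branch_expansion:
  assumes x: "x \<in> {xL..xR}" and y: "y \<in> {yL..yR}" and t: "t \<in> {0..T}" "t + \<tau> \<in> {0..T}"
    and dx: "\<bar>dx\<bar> \<le> s" and dy: "\<bar>dy\<bar> \<le> s" and s: "s \<le> xR - xL" "s \<le> yR - yL"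
    and \<tau>: "0 \<le> \<tau>" "\<tau> \<le> s" "\<tau> \<le> s\<^sup>2"
  shows "\<bar>d [] (reflect xL xR (x + dx)) (reflect yL yR (y + dy)) (t + \<tau>)
      - (d [] x y t + \<tau> * d [Dt] x y t + d [Dx] x y t * dx + d [Dy] x y t * dy
         + 1/2 * d [Dx, Dx] x y t * dx\<^sup>2 + d [Dx, Dy] x y t * (dx * dy) + 1/2 * d [Dy, Dy] x y t * dy\<^sup>2)\<bar>
    \<le> 15 * K * s ^ 3"
proof -
  define X where "X = reflect xL xR (x + dx)"
  define Y where "Y = reflect yL yR (y + dy)"
  have wx: "\<bar>dx\<bar> \<le> xR - xL" and wy: "\<bar>dy\<bar> \<le> yR - yL" using dx dy s by auto
  have X: "X \<in> {xL..xR}" "\<bar>X - x\<bar> \<le> s"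
    using reflect_in_interval[OF x wx] reflect_displacement[OF x wx] dx by (auto simp: X_def)
  have Y: "Y \<in> {yL..yR}" "\<bar>Y - y\<bar> \<le> s"
    using reflect_in_interval[OF y wy] reflect_displacement[OF y wy] dy by (auto simp: Y_def)
  have s0: "0 \<le> s" using dx by linarith
  note K0 = K_nonneg
  have sq: "u\<^sup>2 \<le> s\<^sup>2" if "\<bar>u\<bar> \<le> s" for u :: real
    using that s0 by (metis abs_le_square_iff abs_of_nonneg)
  have Ks3: "0 \<le> K * s ^ 3" using K0 s0 by simp
  \<comment> \<open>One variable at a time: first \<open>t\<close>, then the \<open>x\<close>-displacement with \<open>Y\<close> held fixed, then \<open>y\<close>.
      The coefficients produced at \<open>(x, Y)\<close> are in turn moved back to \<open>(x, y)\<close>.\<close>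
  have "\<bar>d [] X Y (t + \<tau>) - d [] X Y t - d [Dt] X Y t * (t + \<tau> - t)\<bar> \<le> K * (t + \<tau> - t)\<^sup>2"
    by (rule taylor_first_order[where g = "d [] X Y" and g' = "d [Dt] X Y" and g'' = "d [Dt, Dt] X Y", OF _ _ _ t])
       (use X Y bound deriv_t[of "[]"] deriv_t[of "[Dt]"] in auto)
  also have "\<dots> \<le> K * s ^ 3"
    using mult_mono[OF \<tau>(3,2)] s0 \<tau>(1)
    by (intro mult_left_mono[OF _ K0]) (simp add: power2_eq_square power3_eq_cube)
  finally have e1: "\<bar>d [] X Y (t + \<tau>) - d [] X Y t - \<tau> * d [Dt] X Y t\<bar> \<le> K * s ^ 3"
    by (simp add: mult.commute)
  have "\<bar>d [Dt] X Y t - d [Dt] x Y t\<bar> \<le> K * \<bar>X - x\<bar>"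
    by (rule lipschitz_x) (use x X Y t in auto)
  moreover have "\<bar>d [Dt] x Y t - d [Dt] x y t\<bar> \<le> K * \<bar>Y - y\<bar>"
    by (rule lipschitz_y) (use x y Y t in auto)
  moreover have "K * \<bar>X - x\<bar> \<le> K * s" "K * \<bar>Y - y\<bar> \<le> K * s"
    using K0 X Y by (auto intro: mult_left_mono)
  ultimately have "\<bar>d [Dt] X Y t - d [Dt] x y t\<bar> \<le> 2 * (K * s)" by linarith
  then have "\<tau> * \<bar>d [Dt] X Y t - d [Dt] x y t\<bar> \<le> s\<^sup>2 * (2 * (K * s))"
    using \<tau> by (intro mult_mono) auto
  then have e2: "\<bar>\<tau> * d [Dt] X Y t - \<tau> * d [Dt] x y t\<bar> \<le> 2 * (K * s ^ 3)"
    using \<tau>(1) by (simp add: abs_mult right_diff_distrib[symmetric] power2_eq_square power3_eq_cube ac_simps)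
  have cube: "4 * K * \<bar>u\<bar> ^ 3 \<le> 4 * (K * s ^ 3)" if "\<bar>u\<bar> \<le> s" for u :: real
    using mult_left_mono[OF power_mono[OF that, of 3] K0] by simp
  have "\<bar>d [] X Y t - d [] x Y t - d [Dx] x Y t * dx - 1/2 * d [Dx, Dx] x Y t * dx\<^sup>2\<bar> \<le> 4 * K * \<bar>dx\<bar> ^ 3"
    unfolding X_def
    by (rule reflected_taylor_second_order[where g = "\<lambda>s. d [] s Y t" and g' = "\<lambda>s. d [Dx] s Y t"
          and g'' = "\<lambda>s. d [Dx, Dx] s Y t" and g''' = "\<lambda>s. d [Dx, Dx, Dx] s Y t", OF _ _ _ _ _ _ x wx])
       (use Y t bound wall_x deriv_x[of "[]"] deriv_x[of "[Dx]"] deriv_x[of "[Dx, Dx]"] in auto)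
  then have e3: "\<bar>d [] X Y t - d [] x Y t - d [Dx] x Y t * dx - 1/2 * d [Dx, Dx] x Y t * dx\<^sup>2\<bar>
      \<le> 4 * (K * s ^ 3)"
    using cube[OF dx] by linarith
  have "\<bar>d [] x Y t - d [] x y t - d [Dy] x y t * dy - 1/2 * d [Dy, Dy] x y t * dy\<^sup>2\<bar> \<le> 4 * K * \<bar>dy\<bar> ^ 3"
    unfolding Y_def
    by (rule reflected_taylor_second_order[where g = "\<lambda>s. d [] x s t" and g' = "\<lambda>s. d [Dy] x s t"
          and g'' = "\<lambda>s. d [Dy, Dy] x s t" and g''' = "\<lambda>s. d [Dy, Dy, Dy] x s t", OF _ _ _ _ _ _ y wy])
       (use x t bound wall_y deriv_y[of "[]"] deriv_y[of "[Dy]"] deriv_y[of "[Dy, Dy]"] in auto)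
  then have e4: "\<bar>d [] x Y t - d [] x y t - d [Dy] x y t * dy - 1/2 * d [Dy, Dy] x y t * dy\<^sup>2\<bar>
      \<le> 4 * (K * s ^ 3)"
    using cube[OF dy] by linarith
  \<comment> \<open>The point \<open>Y\<close> is itself reflected, so expanding \<open>f\<^sub>x\<close> in \<open>y\<close> needs \<open>f\<^sub>x\<^sub>y = 0\<close> at the wall.\<close>
  have "\<bar>d [Dx] x Y t - d [Dx] x y t - d [Dx, Dy] x y t * dy\<bar> \<le> 3 * K * dy\<^sup>2"
    unfolding Y_def
    by (rule reflected_taylor_first_order[where g = "\<lambda>s. d [Dx] x s t" and g' = "\<lambda>s. d [Dx, Dy] x s t"
          and g'' = "\<lambda>s. d [Dx, Dy, Dy] x s t", OF _ _ _ _ _ y wy])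
       (use x t bound wall_xy deriv_y[of "[Dx]"] deriv_y[of "[Dx, Dy]"] in auto)
  also have "\<dots> \<le> 3 * K * s\<^sup>2" using K0 sq[OF dy] by (simp add: mult_left_mono)
  finally have "\<bar>dx\<bar> * \<bar>d [Dx] x Y t - d [Dx] x y t - d [Dx, Dy] x y t * dy\<bar> \<le> s * (3 * K * s\<^sup>2)"
    using dx s0 by (intro mult_mono) auto
  then have e5: "\<bar>d [Dx] x Y t * dx - d [Dx] x y t * dx - d [Dx, Dy] x y t * (dx * dy)\<bar> \<le> 3 * (K * s ^ 3)"
    unfolding abs_mult[symmetric] by (simp add: algebra_simps power2_eq_square power3_eq_cube)
  have "\<bar>d [Dx, Dx] x Y t - d [Dx, Dx] x y t\<bar> \<le> K * \<bar>Y - y\<bar>"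
    by (rule lipschitz_y) (use x y Y t in auto)
  also have "\<dots> \<le> K * s" using K0 Y by (auto intro: mult_left_mono)
  finally have "dx\<^sup>2 * \<bar>d [Dx, Dx] x Y t - d [Dx, Dx] x y t\<bar> \<le> s\<^sup>2 * (K * s)"
    using sq[OF dx] by (intro mult_mono) auto
  then have "\<bar>dx\<^sup>2 * (d [Dx, Dx] x Y t - d [Dx, Dx] x y t)\<bar> \<le> K * s ^ 3"
    by (simp add: abs_mult power2_eq_square power3_eq_cube ac_simps)
  then have e6: "\<bar>1/2 * d [Dx, Dx] x Y t * dx\<^sup>2 - 1/2 * d [Dx, Dx] x y t * dx\<^sup>2\<bar> \<le> K * s ^ 3"
    using Ks3 unfolding right_diff_distrib mult.commute[of "dx\<^sup>2"] by linarith
  \<comment> \<open>The six remainders in the order of their derivation: \<open>15 = 1 + 2 + 4 + 4 + 3 + 1\<close>.\<close>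
  have "\<bar>d [] X Y (t + \<tau>)
      - (d [] x y t + \<tau> * d [Dt] x y t + d [Dx] x y t * dx + d [Dy] x y t * dy
         + 1/2 * d [Dx, Dx] x y t * dx\<^sup>2 + d [Dx, Dy] x y t * (dx * dy) + 1/2 * d [Dy, Dy] x y t * dy\<^sup>2)\<bar>
    \<le> 15 * (K * s ^ 3)"
    using e1 e2 e3 e4 e5 e6 by linarith
  then show ?thesis by (simp add: X_def Y_def)
qed

end

section \<open>Moments of the branch points\<close>

text \<open>
  The angle is half of \<open>arcsin \<rho>\<close> precisely so that \<open>2 sin \<theta> cos \<theta> = \<rho>\<close>.
\<close>

lemma squared_sum_half_arcsin:
  fixes \<rho> :: real
  assumes "\<rho> \<in> {-1..1}"
  defines "\<theta> \<equiv> 1/2 * arcsin \<rho>"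
  shows "(sin \<theta> + cos \<theta>)\<^sup>2 = 1 + \<rho>" "(sin \<theta> - cos \<theta>)\<^sup>2 = 1 - \<rho>"
proof -
  have "2 * sin \<theta> * cos \<theta> = sin (2 * \<theta>)" by (rule sin_double[symmetric])
  also have "\<dots> = \<rho>" using assms by simp
  finally have "2 * (sin \<theta> * cos \<theta>) = \<rho>" by simp
  then show "(sin \<theta> + cos \<theta>)\<^sup>2 = 1 + \<rho>" "(sin \<theta> - cos \<theta>)\<^sup>2 = 1 - \<rho>"
    using sin_cos_squared_add[of \<theta>] by (simp_all add: power2_sum power2_diff)
qed

lemma displacement_bound:
  fixes b c s B q :: real
  assumes "\<bar>b\<bar> \<le> B" "\<bar>c\<bar> \<le> 2" "\<bar>s\<bar> \<le> B" "0 \<le> q" "q \<le> 1"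
  shows "\<bar>b * q\<^sup>2 + c * s * q\<bar> \<le> 3 * B * q" "\<bar>b * q\<^sup>2 - c * s * q\<bar> \<le> 3 * B * q"
proof -
  have "\<bar>b\<bar> * q\<^sup>2 \<le> B * q"
    using assms mult_mono[of "\<bar>b\<bar>" B "q\<^sup>2" q] by (simp add: power2_eq_square mult_left_le)
  moreover have "\<bar>c\<bar> * \<bar>s\<bar> * q \<le> 2 * B * q"
    using assms by (intro mult_right_mono mult_mono) auto
  ultimately have "\<bar>b * q\<^sup>2\<bar> + \<bar>c * s * q\<bar> \<le> 3 * B * q"
    using assms by (simp add: abs_mult)
  then show "\<bar>b * q\<^sup>2 + c * s * q\<bar> \<le> 3 * B * q" "\<bar>b * q\<^sup>2 - c * s * q\<bar> \<le> 3 * B * q"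
    by linarith+
qed

lemma branch_point_displacement:
  assumes "\<bar>\<sigma>1\<bar> \<le> B" "\<bar>\<sigma>2\<bar> \<le> B" "\<bar>b1\<bar> \<le> B" "\<bar>b2\<bar> \<le> B" "0 \<le> \<tau>" "\<tau> \<le> 1"
    and "(p, q) \<in> set (branch_points x y \<tau> \<rho> \<sigma>1 \<sigma>2 b1 b2)"
  shows "\<bar>p - x\<bar> \<le> 3 * B * sqrt \<tau>" "\<bar>q - y\<bar> \<le> 3 * B * sqrt \<tau>"
proof -
  define \<theta> where "\<theta> = 1/2 * arcsin \<rho>"
  define \<alpha> where "\<alpha> = sin \<theta> + cos \<theta>"
  define \<beta> where "\<beta> = sin \<theta> - cos \<theta>"
  have \<alpha>\<beta>: "\<bar>\<alpha>\<bar> \<le> 2" "\<bar>\<beta>\<bar> \<le> 2"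
    using abs_sin_le_one[of \<theta>] abs_cos_le_one[of \<theta>] unfolding \<alpha>_def \<beta>_def by linarith+
  have \<tau>: "(sqrt \<tau>)\<^sup>2 = \<tau>" "0 \<le> sqrt \<tau>" "sqrt \<tau> \<le> 1" using assms by auto
  note disp = displacement_bound[OF _ _ _ \<tau>(2,3), unfolded \<tau>(1)]
  have "p - x \<in> {b1 * \<tau> + \<alpha> * \<sigma>1 * sqrt \<tau>, b1 * \<tau> - \<beta> * \<sigma>1 * sqrt \<tau>,
        b1 * \<tau> - \<alpha> * \<sigma>1 * sqrt \<tau>, b1 * \<tau> + \<beta> * \<sigma>1 * sqrt \<tau>}"
    "q - y \<in> {b2 * \<tau> + \<alpha> * \<sigma>2 * sqrt \<tau>, b2 * \<tau> - \<beta> * \<sigma>2 * sqrt \<tau>,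
        b2 * \<tau> - \<alpha> * \<sigma>2 * sqrt \<tau>, b2 * \<tau> + \<beta> * \<sigma>2 * sqrt \<tau>}"
    using assms(7)
    unfolding branch_points_def Let_def \<theta>_def[symmetric] \<alpha>_def[symmetric] \<beta>_def[symmetric]
    by auto
  then show "\<bar>p - x\<bar> \<le> 3 * B * sqrt \<tau>" "\<bar>q - y\<bar> \<le> 3 * B * sqrt \<tau>"
    using disp[OF assms(3) \<alpha>\<beta>(1) assms(1)] disp[OF assms(3) \<alpha>\<beta>(2) assms(1)]
      disp[OF assms(4) \<alpha>\<beta>(1) assms(2)] disp[OF assms(4) \<alpha>\<beta>(2) assms(2)]
    by (metis empty_iff insert_iff)+
qed

text \<open>
  The equally weighted branches have the drift as mean displacement and the covariance of the diffusion as
  second moments, up to order \<open>\<tau>\<^sup>2\<close>. So the sum of the expansions reproduces the differential operator, and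
  the error is that of the third-order remainders.
\<close>

lemma (in neumann_field) branch_sum_consistent:
  assumes x: "x \<in> {xL..xR}" and y: "y \<in> {yL..yR}" and t: "t \<in> {0..T}" "t + \<tau> \<in> {0..T}"
    and \<tau>: "0 < \<tau>" "\<tau> \<le> 1"
    and B: "1 \<le> B" "\<bar>\<sigma>1\<bar> \<le> B" "\<bar>\<sigma>2\<bar> \<le> B" "\<bar>b1\<bar> \<le> B" "\<bar>b2\<bar> \<le> B" and \<rho>: "\<rho> \<in> {-1..1}"
    and small: "3 * B * sqrt \<tau> \<le> xR - xL" "3 * B * sqrt \<tau> \<le> yR - yL"
  shows "\<bar>(\<Sum>(p, q)\<leftarrow>branch_points x y \<tau> \<rho> \<sigma>1 \<sigma>2 b1 b2.
             d [] (reflect xL xR p) (reflect yL yR q) (t + \<tau>))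
      - 4 * (d [] x y t + \<tau> * (d [Dt] x y t + 1/2 * \<sigma>1\<^sup>2 * d [Dx, Dx] x y t
          + \<rho> * \<sigma>1 * \<sigma>2 * d [Dx, Dy] x y t + 1/2 * \<sigma>2\<^sup>2 * d [Dy, Dy] x y t
          + b1 * d [Dx] x y t + b2 * d [Dy] x y t))\<bar>
    \<le> 1628 * K * B ^ 3 * sqrt \<tau> ^ 3"
proof -
  define q where "q = sqrt \<tau>"
  have q: "0 < q" "q \<le> 1" "\<tau> = q\<^sup>2" using \<tau> by (auto simp: q_def)
  define \<theta> where "\<theta> = 1/2 * arcsin \<rho>"
  define \<alpha> where "\<alpha> = sin \<theta> + cos \<theta>"
  define \<beta> where "\<beta> = sin \<theta> - cos \<theta>"
  have \<alpha>: "\<bar>\<alpha>\<bar> \<le> 2" "\<alpha>\<^sup>2 = 1 + \<rho>"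
    using squared_sum_half_arcsin(1)[OF \<rho>, folded \<theta>_def]
      abs_sin_le_one[of \<theta>] abs_cos_le_one[of \<theta>] unfolding \<alpha>_def by linarith+
  have \<beta>: "\<bar>\<beta>\<bar> \<le> 2" "\<beta>\<^sup>2 = 1 - \<rho>"
    using squared_sum_half_arcsin(2)[OF \<rho>, folded \<theta>_def]
      abs_sin_le_one[of \<theta>] abs_cos_le_one[of \<theta>] unfolding \<beta>_def by linarith+
  define s where "s = 3 * B * q"
  define F where "F dx dy = d [] (reflect xL xR (x + dx)) (reflect yL yR (y + dy)) (t + \<tau>)" for dx dy
  define P where "P dx dy = d [] x y t + \<tau> * d [Dt] x y t + d [Dx] x y t * dx + d [Dy] x y t * dy
         + 1/2 * d [Dx, Dx] x y t * dx\<^sup>2 + d [Dx, Dy] x y t * (dx * dy) + 1/2 * d [Dy, Dy] x y t * dy\<^sup>2"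
    for dx dy
  have qs: "q \<le> s" using B(1) q mult_right_mono[of 1 "3 * B" q] by (simp add: s_def)
  have "q\<^sup>2 \<le> s\<^sup>2" using qs q by (simp add: power_mono)
  moreover have "q\<^sup>2 \<le> q" using q by (simp add: power2_eq_square mult_left_le)
  ultimately have \<tau>s: "\<tau> \<le> s" "\<tau> \<le> s\<^sup>2" using qs q(3) by auto
  have FP: "\<bar>F dx dy - P dx dy\<bar> \<le> 15 * K * s ^ 3" if "\<bar>dx\<bar> \<le> s" "\<bar>dy\<bar> \<le> s" for dx dy
    unfolding F_def P_def
    by (rule reflected_branch_expansion) (use x y t \<tau> \<tau>s small that in \<open>auto simp: s_def q_def\<close>)
  have q2: "0 \<le> q" using q by simp
  note disp = displacement_bound[OF _ _ _ q2 q(2), where B = B, folded s_def]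
  let ?F = "F (b1 * q\<^sup>2 + \<alpha> * \<sigma>1 * q) (b2 * q\<^sup>2 + \<alpha> * \<sigma>2 * q)
    + F (b1 * q\<^sup>2 - \<beta> * \<sigma>1 * q) (b2 * q\<^sup>2 + \<beta> * \<sigma>2 * q)
    + F (b1 * q\<^sup>2 - \<alpha> * \<sigma>1 * q) (b2 * q\<^sup>2 - \<alpha> * \<sigma>2 * q)
    + F (b1 * q\<^sup>2 + \<beta> * \<sigma>1 * q) (b2 * q\<^sup>2 - \<beta> * \<sigma>2 * q)"
  let ?P = "P (b1 * q\<^sup>2 + \<alpha> * \<sigma>1 * q) (b2 * q\<^sup>2 + \<alpha> * \<sigma>2 * q)
    + P (b1 * q\<^sup>2 - \<beta> * \<sigma>1 * q) (b2 * q\<^sup>2 + \<beta> * \<sigma>2 * q)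
    + P (b1 * q\<^sup>2 - \<alpha> * \<sigma>1 * q) (b2 * q\<^sup>2 - \<alpha> * \<sigma>2 * q)
    + P (b1 * q\<^sup>2 + \<beta> * \<sigma>1 * q) (b2 * q\<^sup>2 - \<beta> * \<sigma>2 * q)"
  have sumF: "(\<Sum>(p, q)\<leftarrow>branch_points x y \<tau> \<rho> \<sigma>1 \<sigma>2 b1 b2.
             d [] (reflect xL xR p) (reflect yL yR q) (t + \<tau>)) = ?F"
    unfolding branch_points_def Let_def \<theta>_def[symmetric] \<alpha>_def[symmetric] \<beta>_def[symmetric] q_def[symmetric]
    by (simp add: F_def add.assoc add_diff_eq q(3))
  have sum_diff: "\<bar>?F - ?P\<bar> \<le> 4 * (15 * K * s ^ 3)"
  proof -
    note FP' = FP[OF disp(1)[OF B(4) \<alpha>(1) B(2)] disp(1)[OF B(5) \<alpha>(1) B(3)]]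
      FP[OF disp(2)[OF B(4) \<beta>(1) B(2)] disp(1)[OF B(5) \<beta>(1) B(3)]]
      FP[OF disp(2)[OF B(4) \<alpha>(1) B(2)] disp(2)[OF B(5) \<alpha>(1) B(3)]]
      FP[OF disp(1)[OF B(4) \<beta>(1) B(2)] disp(2)[OF B(5) \<beta>(1) B(3)]]
    then show ?thesis by linarith
  qed
  define G where "G = 4 * (d [] x y t + \<tau> * (d [Dt] x y t + 1/2 * \<sigma>1\<^sup>2 * d [Dx, Dx] x y t
          + \<rho> * \<sigma>1 * \<sigma>2 * d [Dx, Dy] x y t + 1/2 * \<sigma>2\<^sup>2 * d [Dy, Dy] x y t
          + b1 * d [Dx] x y t + b2 * d [Dy] x y t))"
  \<comment> \<open>The products of the drifts, of order \<open>\<tau>\<^sup>2\<close>.\<close>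
  define R where "R = q ^ 4 * (2 * (b1\<^sup>2 * d [Dx, Dx] x y t) + 4 * (b1 * b2 * d [Dx, Dy] x y t)
      + 2 * (b2\<^sup>2 * d [Dy, Dy] x y t))"
  \<comment> \<open>The moments of the four displacements: the first-order parts in \<open>q\<close> cancel in pairs, and
      \<open>\<alpha>\<^sup>2 + \<beta>\<^sup>2 = 2\<close>, \<open>\<alpha>\<^sup>2 - \<beta>\<^sup>2 = 2 \<rho>\<close> give the covariance matrix of the diffusion.\<close>
  have "?P = 4 * d [] x y t + 4 * q\<^sup>2 * d [Dt] x y t + 4 * b1 * q\<^sup>2 * d [Dx] x y t
      + 4 * b2 * q\<^sup>2 * d [Dy] x y t
      + (2 * b1\<^sup>2 * q ^ 4 + (\<alpha>\<^sup>2 + \<beta>\<^sup>2) * \<sigma>1\<^sup>2 * q\<^sup>2) * d [Dx, Dx] x y t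
      + (4 * b1 * b2 * q ^ 4 + 2 * (\<alpha>\<^sup>2 - \<beta>\<^sup>2) * \<sigma>1 * \<sigma>2 * q\<^sup>2) * d [Dx, Dy] x y t
      + (2 * b2\<^sup>2 * q ^ 4 + (\<alpha>\<^sup>2 + \<beta>\<^sup>2) * \<sigma>2\<^sup>2 * q\<^sup>2) * d [Dy, Dy] x y t"
    unfolding P_def q(3) by algebra
  also have "\<dots> = G + R"
    unfolding G_def R_def q(3) \<alpha>(2) \<beta>(2) by (simp add: algebra_simps)
  finally have PG: "?P = G + R" .
  have moment: "\<bar>c * c' * d [v, w] x y t\<bar> \<le> B * B * K" if "\<bar>c\<bar> \<le> B" "\<bar>c'\<bar> \<le> B" for c c' v w
    unfolding abs_mult using that B(1) by (intro mult_mono bound x y t(1)) auto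
  have "\<bar>R\<bar> \<le> q ^ 4 * (8 * (B * B * K))"
    unfolding R_def abs_mult power2_eq_square[of b1] power2_eq_square[of b2]
    using moment[OF B(4) B(4), of Dx Dx] moment[OF B(4) B(5), of Dx Dy] moment[OF B(5) B(5), of Dy Dy] q
    by (intro mult_mono) auto
  also have "\<dots> \<le> q ^ 3 * (8 * (B ^ 3 * K))"
  proof (intro mult_mono)
    show "q ^ 4 \<le> q ^ 3" using q by (simp add: power_decreasing)
    show "B * B \<le> B ^ 3" using B(1) by (simp add: power3_eq_cube)
  qed (use q B(1) K_nonneg in auto)
  finally have R: "\<bar>R\<bar> \<le> 8 * (K * B ^ 3 * q ^ 3)" by (simp add: ac_simps)
  \<comment> \<open>\<open>4 \<cdot> 15 \<cdot> 27 = 1620\<close> from the remainders of the four branches, and \<open>8\<close> from the drifts.\<close>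
  have "s ^ 3 = 27 * (B ^ 3 * q ^ 3)" by (simp add: s_def power_mult_distrib)
  then have "\<bar>?F - ?P\<bar> \<le> 1620 * (K * B ^ 3 * q ^ 3)" using sum_diff by simp
  then have "\<bar>?F - G\<bar> \<le> 1628 * (K * B ^ 3 * q ^ 3)" using R PG by linarith
  then show ?thesis unfolding sumF G_def by (simp add: q_def)
qed

section \<open>Bilinear interpolation on the grid\<close>

text \<open>
  Expanding both end values about the interpolation point, the first-order terms cancel by the choice of
  the weights.
\<close>

lemma linear_interpolation_error:
  fixes g g' g'' :: "real \<Rightarrow> real"
  assumes g: "\<And>z. z \<in> {a..b} \<Longrightarrow> (g has_real_derivative g' z) (at z within {a..b})"
    and g': "\<And>z. z \<in> {a..b} \<Longrightarrow> (g' has_real_derivative g'' z) (at z within {a..b})"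
    and K: "\<And>z. z \<in> {a..b} \<Longrightarrow> \<bar>g'' z\<bar> \<le> K"
    and p: "p \<in> {a..b}" "p + h \<in> {a..b}" "0 \<le> h" and u: "u \<in> {0..1}"
  shows "\<bar>(1 - u) * g p + u * g (p + h) - g (p + u * h)\<bar> \<le> K * h\<^sup>2"
proof -
  define z where "z = p + u * h"
  have uh: "0 \<le> u * h" "u * h \<le> h" using p u by (auto simp: mult_left_le_one_le)
  then have z: "z \<in> {a..b}" using p by (auto simp: z_def)
  have K0: "0 \<le> K" using K[OF z] by linarith
  have u2: "u\<^sup>2 \<le> 1" "(1 - u)\<^sup>2 \<le> 1" using u by (auto simp: power_le_one)
  have "\<bar>g p - g z - g' z * (p - z)\<bar> \<le> K * (p - z)\<^sup>2"
    by (rule taylor_first_order[OF g g' K z p(1)])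
  also have "\<dots> = u\<^sup>2 * (K * h\<^sup>2)" by (simp add: z_def power_mult_distrib)
  also have "\<dots> \<le> K * h\<^sup>2" using u2 K0 by (simp add: mult_left_le_one_le)
  finally have 1: "(1 - u) * \<bar>g p - g z - g' z * (p - z)\<bar> \<le> (1 - u) * (K * h\<^sup>2)"
    using u by (intro mult_left_mono) auto
  have "\<bar>g (p + h) - g z - g' z * (p + h - z)\<bar> \<le> K * (p + h - z)\<^sup>2"
    by (rule taylor_first_order[OF g g' K z p(2)])
  also have "\<dots> = (1 - u)\<^sup>2 * (K * h\<^sup>2)" by (simp add: z_def power2_eq_square algebra_simps)
  also have "\<dots> \<le> K * h\<^sup>2" using u2 K0 by (simp add: mult_left_le_one_le)
  finally have 2: "u * \<bar>g (p + h) - g z - g' z * (p + h - z)\<bar> \<le> u * (K * h\<^sup>2)"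
    using u by (intro mult_left_mono) auto
  have "(1 - u) * g p + u * g (p + h) - g z
      = (1 - u) * (g p - g z - g' z * (p - z)) + u * (g (p + h) - g z - g' z * (p + h - z))"
    by (simp add: z_def algebra_simps)
  also have "\<bar>\<dots>\<bar> \<le> (1 - u) * \<bar>g p - g z - g' z * (p - z)\<bar> + u * \<bar>g (p + h) - g z - g' z * (p + h - z)\<bar>"
    using u by (intro order_trans[OF abs_triangle_ineq]) (simp add: abs_mult)
  also have "\<dots> \<le> K * h\<^sup>2" using add_mono[OF 1 2] by (simp add: algebra_simps)
  finally show ?thesis by (simp add: z_def)
qed

lemma abs_convex_combination_le:
  fixes u p q E :: real
  assumes "u \<in> {0..1}" "\<bar>p\<bar> \<le> E" "\<bar>q\<bar> \<le> E"
  shows "\<bar>(1 - u) * p + u * q\<bar> \<le> E"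
proof -
  have "\<bar>(1 - u) * p + u * q\<bar> \<le> (1 - u) * \<bar>p\<bar> + u * \<bar>q\<bar>"
    using assms by (intro order_trans[OF abs_triangle_ineq]) (simp add: abs_mult)
  also have "\<dots> \<le> (1 - u) * E + u * E"
    using assms by (intro add_mono mult_left_mono) auto
  finally show ?thesis by (simp add: algebra_simps)
qed

lemma mesh_pos: "a < b \<Longrightarrow> M \<ge> 1 \<Longrightarrow> 0 < mesh a b M"
  by (simp add: mesh_def)

lemma node_Suc: "node a b M (Suc i) = node a b M i + mesh a b M"
  by (simp add: node_def algebra_simps)

lemma node_last: "M \<ge> 1 \<Longrightarrow> node a b M M = b"
  by (simp add: node_def mesh_def)

lemma node_strict_mono: "a < b \<Longrightarrow> M \<ge> 1 \<Longrightarrow> i < j \<Longrightarrow> node a b M i < node a b M j"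
  using mesh_pos by (simp add: node_def)

lemma node_in: "a < b \<Longrightarrow> M \<ge> 1 \<Longrightarrow> i \<le> M \<Longrightarrow> node a b M i \<in> {a..b}"
  using node_strict_mono[of a b M 0 i] node_strict_mono[of a b M i M] node_last[of M a b]
  by (cases "i = 0"; cases "i = M") (auto simp: node_def)

lemma node_interior:
  assumes "a < b" "M \<ge> 2" "i \<in> {1..M-1}"
  shows "node a b M i \<in> {a<..<b}"
proof -
  have "0 < i" "i < M" "M \<ge> 1" using assms by auto
  then show ?thesis
    using node_strict_mono[of a b M 0 i] node_strict_mono[of a b M i M] node_last[of M a b] assms(1)
    by (simp add: node_def)
qed

lemma cell_coordinate:
  assumes ab: "a < b" "M \<ge> 1" and z: "z \<in> {a..b}"
  defines "i \<equiv> cell_index a b M z"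
  defines "u \<equiv> (z - node a b M i) / mesh a b M"
  shows "i < M" "u \<in> {0..1}" "z = node a b M i + u * mesh a b M"
proof -
  have h: "0 < mesh a b M" by (rule mesh_pos[OF ab])
  define v where "v = (z - a) / mesh a b M"
  have v: "0 \<le> v" "v \<le> real M"
    using z h ab by (auto simp: v_def field_simps mesh_def)
  have i: "i = min (M - 1) (nat \<lfloor>v\<rfloor>)" by (simp add: i_def cell_index_def v_def)
  show "i < M" using ab i by auto
  have uv: "u = v - real i" using h by (simp add: u_def v_def node_def field_simps)
  have "real i \<le> v" using i v(1) by linarith
  moreover have "v \<le> real i + 1"
  proof (cases "nat \<lfloor>v\<rfloor> \<le> M - 1")
    case True
    then have "i = nat \<lfloor>v\<rfloor>" using i by simp
    then show ?thesis using v(1) by linarith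
  next
    case False
    then have "i = M - 1" using i by simp
    then show ?thesis using v(2) ab by (simp add: of_nat_diff)
  qed
  ultimately show "u \<in> {0..1}" using uv by simp
  show "z = node a b M i + u * mesh a b M" using h by (simp add: u_def)
qed

lemma bilinear_diff:
  "bilinear xL xR yL yR M1 M2 g x y - bilinear xL xR yL yR M1 M2 g' x y
     = bilinear xL xR yL yR M1 M2 (\<lambda>i j. g i j - g' i j) x y"
  by (simp add: bilinear_def Let_def algebra_simps)

text \<open>
  The weights are nonnegative with sum \<open>1\<close>. This maximum principle is what makes the scheme stable.
\<close>

lemma bilinear_abs_le:
  assumes "xL < xR" "M1 \<ge> 1" "x \<in> {xL..xR}" "yL < yR" "M2 \<ge> 1" "y \<in> {yL..yR}"
    and g: "\<And>i j. i \<le> M1 \<Longrightarrow> j \<le> M2 \<Longrightarrow> \<bar>g i j\<bar> \<le> E"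
  shows "\<bar>bilinear xL xR yL yR M1 M2 g x y\<bar> \<le> E"
proof -
  define i where "i = cell_index xL xR M1 x"
  define j where "j = cell_index yL yR M2 y"
  define u where "u = (x - node xL xR M1 i) / mesh xL xR M1"
  define v where "v = (y - node yL yR M2 j) / mesh yL yR M2"
  note cx = cell_coordinate[OF assms(1-3), folded i_def, folded u_def]
  note cy = cell_coordinate[OF assms(4-6), folded j_def, folded v_def]
  have "bilinear xL xR yL yR M1 M2 g x y =
      (1 - v) * ((1 - u) * g i j + u * g (Suc i) j) + v * ((1 - u) * g i (Suc j) + u * g (Suc i) (Suc j))"
    unfolding bilinear_def Let_def i_def[symmetric] j_def[symmetric] u_def[symmetric] v_def[symmetric]
    by (simp add: algebra_simps)
  also have "\<bar>\<dots>\<bar> \<le> E"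
    using cx cy by (intro abs_convex_combination_le g) auto
  finally show ?thesis .
qed

lemma (in neumann_field) bilinear_error:
  assumes M: "M1 \<ge> 1" "M2 \<ge> 1" and h: "mesh xL xR M1 = h" "mesh yL yR M2 = h"
    and x: "x \<in> {xL..xR}" and y: "y \<in> {yL..yR}" and t: "t \<in> {0..T}"
  shows "\<bar>bilinear xL xR yL yR M1 M2 (\<lambda>i j. d [] (node xL xR M1 i) (node yL yR M2 j) t) x y - d [] x y t\<bar>
    \<le> 2 * K * h\<^sup>2"
proof -
  define i where "i = cell_index xL xR M1 x"
  define j where "j = cell_index yL yR M2 y"
  define u where "u = (x - node xL xR M1 i) / h"
  define v where "v = (y - node yL yR M2 j) / h"
  define p where "p = node xL xR M1 i"
  define q where "q = node yL yR M2 j"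
  note cx = cell_coordinate[OF box(1) M(1) x, folded i_def, unfolded h, folded u_def]
  note cy = cell_coordinate[OF box(2) M(2) y, folded j_def, unfolded h, folded v_def]
  have h0: "0 \<le> h" using mesh_pos[OF box(1) M(1)] h by simp
  have pq: "node xL xR M1 (Suc i) = p + h" "node yL yR M2 (Suc j) = q + h"
    by (simp_all add: p_def q_def node_Suc h)
  have p: "p \<in> {xL..xR}" "p + h \<in> {xL..xR}"
    using node_in[OF box(1) M(1), of i] node_in[OF box(1) M(1), of "Suc i"] cx(1)
    by (auto simp: pq(1)[symmetric]) (auto simp: p_def)
  have q: "q \<in> {yL..yR}" "q + h \<in> {yL..yR}"
    using node_in[OF box(2) M(2), of j] node_in[OF box(2) M(2), of "Suc j"] cy(1)
    by (auto simp: pq(2)[symmetric]) (auto simp: q_def)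
  let ?I = "\<lambda>z. (1 - u) * d [] p z t + u * d [] (p + h) z t"
  have ix: "\<bar>?I z - d [] x z t\<bar> \<le> K * h\<^sup>2" if z: "z \<in> {yL..yR}" for z
  proof -
    have "\<bar>?I z - d [] (p + u * h) z t\<bar> \<le> K * h\<^sup>2"
      by (rule linear_interpolation_error[where g = "\<lambda>s. d [] s z t" and g' = "\<lambda>s. d [Dx] s z t"
            and g'' = "\<lambda>s. d [Dx, Dx] s z t", OF _ _ _ p h0 cx(2)])
         (use z t bound deriv_x[of "[]"] deriv_x[of "[Dx]"] in auto)
    then show ?thesis using cx(3) by (simp add: p_def)
  qed
  have "\<bar>(1 - v) * d [] x q t + v * d [] x (q + h) t - d [] x (q + v * h) t\<bar> \<le> K * h\<^sup>2"
    by (rule linear_interpolation_error[where g = "\<lambda>s. d [] x s t" and g' = "\<lambda>s. d [Dy] x s t"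
          and g'' = "\<lambda>s. d [Dy, Dy] x s t", OF _ _ _ q h0 cy(2)])
       (use x t bound deriv_y[of "[]"] deriv_y[of "[Dy]"] in auto)
  then have iy: "\<bar>(1 - v) * d [] x q t + v * d [] x (q + h) t - d [] x y t\<bar> \<le> K * h\<^sup>2"
    using cy(3) by (simp add: q_def)
  have "\<bar>(1 - v) * (?I q - d [] x q t) + v * (?I (q + h) - d [] x (q + h) t)\<bar> \<le> K * h\<^sup>2"
    by (intro abs_convex_combination_le ix q cy(2))
  moreover have "bilinear xL xR yL yR M1 M2 (\<lambda>i j. d [] (node xL xR M1 i) (node yL yR M2 j) t) x y
      = (1 - v) * ?I q + v * ?I (q + h)"
    unfolding bilinear_def Let_def h i_def[symmetric] j_def[symmetric] u_def[symmetric] v_def[symmetric]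
    unfolding pq p_def[symmetric] q_def[symmetric]
    by (simp add: algebra_simps)
  ultimately show ?thesis using iy by (simp add: algebra_simps)
qed

section \<open>Propagation of the error\<close>

text \<open>
  The interior node whose value the scheme copies to the given node; at a corner both coordinates move.
\<close>

definition interior_index :: "nat \<Rightarrow> nat \<Rightarrow> nat" where
  "interior_index M i = max 1 (min (M - 1) i)"

lemma interior_index_range: "M \<ge> 2 \<Longrightarrow> interior_index M i \<in> {1..M - 1}"
  by (auto simp: interior_index_def)

lemma interior_index_cases:
  assumes "M \<ge> 2" "i \<le> M"
  obtains "interior_index M i = i" | "i = 0" "interior_index M i = 1" | "i = M" "interior_index M i = M - 1"
  using assms by (cases "i = 0"; cases "i = M") (auto simp: interior_index_def)

lemma reflective_scheme_boundary:
  assumes "reflective_scheme xL xR yL yR T \<rho> \<sigma>1 \<sigma>2 r b1 b2 \<phi> M1 M2 N fh"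
    and "n < N" "M1 \<ge> 2" "M2 \<ge> 2" "i \<le> M1" "j \<le> M2"
  shows "fh n i j = fh n (interior_index M1 i) (interior_index M2 j)"
proof -
  have x: "\<And>j. j \<le> M2 \<Longrightarrow> fh n 0 j = fh n 1 j \<and> fh n M1 j = fh n (M1 - 1) j"
    and y: "\<And>i. i \<le> M1 \<Longrightarrow> fh n i 0 = fh n i 1 \<and> fh n i M2 = fh n i (M2 - 1)"
    using assms(1,2) unfolding reflective_scheme_def by blast+
  have "fh n i j = fh n (interior_index M1 i) j"
    using interior_index_cases[OF assms(3,5)] x[OF assms(6)] by metis
  also have "\<dots> = fh n (interior_index M1 i) (interior_index M2 j)"
    using interior_index_cases[OF assms(4,6)] y[of "interior_index M1 i"] interior_index_range[OF assms(3), of i]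
    by (metis atLeastAtMost_iff diff_le_self le_trans)
  finally show ?thesis .
qed

context neumann_field
begin

text \<open>
  Copying a neighbouring value costs only \<open>h\<^sup>2\<close>, because the normal derivative vanishes at the wall.
\<close>

lemma boundary_increment_x:
  assumes "M \<ge> 2" "i \<le> M" and y: "y \<in> {yL..yR}" and t: "t \<in> {0..T}"
  shows "\<bar>d [] (node xL xR M (interior_index M i)) y t - d [] (node xL xR M i) y t\<bar> \<le> K * (mesh xL xR M)\<^sup>2"
proof -
  have M: "M \<ge> 1" using assms(1) by simp
  have wall: "\<bar>d [] z y t - d [] c y t\<bar> \<le> K * (z - c)\<^sup>2" if "c \<in> {xL, xR}" "z \<in> {xL..xR}" for c z
  proof -
    have c: "c \<in> {xL..xR}" using that(1) box by auto
    have "\<bar>d [] z y t - d [] c y t - d [Dx] c y t * (z - c)\<bar> \<le> K * (z - c)\<^sup>2"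
      by (rule taylor_first_order[where g = "\<lambda>s. d [] s y t" and g' = "\<lambda>s. d [Dx] s y t"
            and g'' = "\<lambda>s. d [Dx, Dx] s y t", OF _ _ _ c that(2)])
         (use y t bound deriv_x[of "[]"] deriv_x[of "[Dx]"] in auto)
    then show ?thesis using wall_x[OF that(1) y t] by simp
  qed
  from assms(1,2) show ?thesis
  proof (cases rule: interior_index_cases)
    case 1
    then show ?thesis using K_nonneg by simp
  next
    case 2
    then show ?thesis
      using wall[of xL "node xL xR M 1"] node_in[OF box(1) M, of 1] M by (simp add: node_def)
  next
    case 3
    have "node xL xR M (M - 1) = xR - mesh xL xR M"
      using node_Suc[of xL xR M "M - 1"] node_last[OF M, of xL xR] M by simp
    then show ?thesis
      using 3 wall[of xR "node xL xR M (M - 1)"] node_in[OF box(1) M, of "M - 1"] node_last[OF M, of xL xR]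
      by simp
  qed
qed

lemma boundary_increment_y:
  assumes "M \<ge> 2" "j \<le> M" and x: "x \<in> {xL..xR}" and t: "t \<in> {0..T}"
  shows "\<bar>d [] x (node yL yR M (interior_index M j)) t - d [] x (node yL yR M j) t\<bar> \<le> K * (mesh yL yR M)\<^sup>2"
proof -
  have M: "M \<ge> 1" using assms(1) by simp
  have wall: "\<bar>d [] x z t - d [] x c t\<bar> \<le> K * (z - c)\<^sup>2" if "c \<in> {yL, yR}" "z \<in> {yL..yR}" for c z
  proof -
    have c: "c \<in> {yL..yR}" using that(1) box by auto
    have "\<bar>d [] x z t - d [] x c t - d [Dy] x c t * (z - c)\<bar> \<le> K * (z - c)\<^sup>2"
      by (rule taylor_first_order[where g = "\<lambda>s. d [] x s t" and g' = "\<lambda>s. d [Dy] x s t"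
            and g'' = "\<lambda>s. d [Dy, Dy] x s t", OF _ _ _ c that(2)])
         (use x t bound deriv_y[of "[]"] deriv_y[of "[Dy]"] in auto)
    then show ?thesis using wall_y[OF x that(1) t] by simp
  qed
  from assms(1,2) show ?thesis
  proof (cases rule: interior_index_cases)
    case 1
    then show ?thesis using K_nonneg by simp
  next
    case 2
    then show ?thesis
      using wall[of yL "node yL yR M 1"] node_in[OF box(2) M, of 1] M by (simp add: node_def)
  next
    case 3
    have "node yL yR M (M - 1) = yR - mesh yL yR M"
      using node_Suc[of yL yR M "M - 1"] node_last[OF M, of yL yR] M by simp
    then show ?thesis
      using 3 wall[of yR "node yL yR M (M - 1)"] node_in[OF box(2) M, of "M - 1"] node_last[OF M, of yL yR]
      by simp
  qed
qed

text \<open>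
  One step back in time passes on the maximal error unamplified and adds a local error of order
  \<open>h\<^bsup>3/2\<^esup>\<close>, which dominates the interpolation and boundary errors of order \<open>h\<^sup>2\<close>.
\<close>

lemma error_step:
  assumes scheme: "reflective_scheme xL xR yL yR T \<rho> \<sigma>1 \<sigma>2 r b1 b2 \<phi> M1 M2 N fh"
    and pde: "\<And>x y t. x \<in> {xL<..<xR} \<Longrightarrow> y \<in> {yL<..<yR} \<Longrightarrow> t \<in> {0..<T} \<Longrightarrow>
       d [Dt] x y t + 1/2 * (\<sigma>1 x y t)\<^sup>2 * d [Dx, Dx] x y t
       + \<rho> x y t * \<sigma>1 x y t * \<sigma>2 x y t * d [Dx, Dy] x y t
       + 1/2 * (\<sigma>2 x y t)\<^sup>2 * d [Dy, Dy] x y t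
       + b1 x y t * d [Dx] x y t + b2 x y t * d [Dy] x y t = r x y t * d [] x y t"
    and coeff: "\<And>x y t. x \<in> {xL<..<xR} \<Longrightarrow> y \<in> {yL<..<yR} \<Longrightarrow> t \<in> {0..<T} \<Longrightarrow>
       \<rho> x y t \<in> {-1..1} \<and> 0 \<le> r x y t \<and> \<bar>\<sigma>1 x y t\<bar> \<le> B \<and> \<bar>\<sigma>2 x y t\<bar> \<le> B \<and> \<bar>b1 x y t\<bar> \<le> B \<and> \<bar>b2 x y t\<bar> \<le> B"
    and B: "1 \<le> B" and M: "M1 \<ge> 2" "M2 \<ge> 2"
    and h: "mesh 0 T N = h" "mesh xL xR M1 = h" "mesh yL yR M2 = h" "h \<le> 1"
    and small: "3 * B * sqrt h \<le> xR - xL" "3 * B * sqrt h \<le> yR - yL"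
    and n: "n < N"
    and E: "\<And>i j. i \<le> M1 \<Longrightarrow> j \<le> M2 \<Longrightarrow>
       \<bar>fh (Suc n) i j - d [] (node xL xR M1 i) (node yL yR M2 j) (node 0 T N (Suc n))\<bar> \<le> E"
    and ij: "i \<le> M1" "j \<le> M2"
  shows "\<bar>fh n i j - d [] (node xL xR M1 i) (node yL yR M2 j) (node 0 T N n)\<bar>
    \<le> E + 411 * K * B ^ 3 * sqrt h ^ 3"
proof -
  have M': "M1 \<ge> 1" "M2 \<ge> 1" and N: "N \<ge> 1" using M n by auto
  have h0: "0 < h" using mesh_pos[OF box(3) N] h by simp
  define t where "t = node 0 T N n"
  have t: "t \<in> {0..<T}" "t \<in> {0..T}" "t + h \<in> {0..T}" "node 0 T N (Suc n) = t + h"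
    using node_in[OF box(3) N, of n] node_in[OF box(3) N, of "Suc n"] node_Suc[of 0 T N n] h(1) h0 n
    by (auto simp: t_def)
  define K3 where "K3 = K * B ^ 3 * sqrt h ^ 3"
  have Kh: "K * h\<^sup>2 \<le> K3"
  proof -
    have "h\<^sup>2 = sqrt h ^ 4" using h0 power_mult[of "sqrt h" 2 2] by simp
    also have "\<dots> \<le> sqrt h ^ 3" using h0 h(4) by (intro power_decreasing) auto
    also have "\<dots> \<le> B ^ 3 * sqrt h ^ 3" using B h0 mult_right_mono[of 1 "B ^ 3" "sqrt h ^ 3"] by simp
    finally show ?thesis using mult_left_mono[OF _ K_nonneg] by (simp add: K3_def mult.assoc)
  qed
  \<comment> \<open>\<open>409 = 1628 / 4 + 2\<close>: consistency of the mean over the branches, and interpolation.\<close>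
  have interior: "\<bar>fh n k l - d [] (node xL xR M1 k) (node yL yR M2 l) t\<bar> \<le> E + 409 * K3"
    if k: "k \<in> {1..M1-1}" and l: "l \<in> {1..M2-1}" for k l
  proof -
    define x where "x = node xL xR M1 k"
    define y where "y = node yL yR M2 l"
    have xy: "x \<in> {xL<..<xR}" "y \<in> {yL<..<yR}"
      using node_interior[OF box(1) M(1) k] node_interior[OF box(2) M(2) l] by (simp_all add: x_def y_def)
    then have xy': "x \<in> {xL..xR}" "y \<in> {yL..yR}" by auto
    note c = coeff[OF xy t(1)]
    define R where "R = r x y t"
    define bp where "bp = branch_points x y h (\<rho> x y t) (\<sigma>1 x y t) (\<sigma>2 x y t) (b1 x y t) (b2 x y t)"
    let ?I = "\<lambda>g p q. bilinear xL xR yL yR M1 M2 g (reflect xL xR p) (reflect yL yR q)"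
    let ?f = "\<lambda>i j. d [] (node xL xR M1 i) (node yL yR M2 j) (t + h)"
    let ?F = "\<lambda>p q. d [] (reflect xL xR p) (reflect yL yR q) (t + h)"
    have R0: "0 \<le> R" using c by (simp add: R_def)
    have "fh n k l = 1 / (4 * (1 + R * h)) * (\<Sum>(p, q)\<leftarrow>bp. ?I (fh (Suc n)) p q)"
      using scheme n k l h unfolding reflective_scheme_def
      by (simp add: Let_def bp_def x_def y_def t_def R_def)
    moreover have pos: "0 < 4 * (1 + R * h)" using R0 h0 by (simp add: add_pos_nonneg)
    ultimately have fh: "4 * (1 + R * h) * fh n k l = (\<Sum>(p, q)\<leftarrow>bp. ?I (fh (Suc n)) p q)"
      by simp
    have sum: "\<bar>(\<Sum>(p, q)\<leftarrow>bp. ?F p q) - 4 * ((1 + R * h) * d [] x y t)\<bar> \<le> 1628 * K3"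
    proof -
      have "(1 + R * h) * d [] x y t = d [] x y t + h * (d [Dt] x y t + 1/2 * (\<sigma>1 x y t)\<^sup>2 * d [Dx, Dx] x y t
       + \<rho> x y t * \<sigma>1 x y t * \<sigma>2 x y t * d [Dx, Dy] x y t
       + 1/2 * (\<sigma>2 x y t)\<^sup>2 * d [Dy, Dy] x y t
       + b1 x y t * d [Dx] x y t + b2 x y t * d [Dy] x y t)"
        unfolding pde[OF xy t(1)] by (simp add: R_def algebra_simps)
      then show ?thesis
        using branch_sum_consistent[OF xy' t(2,3) h0 h(4) B, of "\<sigma>1 x y t" "\<sigma>2 x y t" "b1 x y t" "b2 x y t" "\<rho> x y t"]
          c small by (simp add: bp_def K3_def mult.assoc)
    qed
    have in_domain: "reflect xL xR p \<in> {xL..xR} \<and> reflect yL yR q \<in> {yL..yR}" if "(p, q) \<in> set bp" for p q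
    proof -
      have "\<bar>p - x\<bar> \<le> 3 * B * sqrt h" "\<bar>q - y\<bar> \<le> 3 * B * sqrt h"
        using branch_point_displacement[OF _ _ _ _ _ _ that[unfolded bp_def]] c h0 h(4) by auto
      then show ?thesis
        using reflect_in_interval[OF xy'(1), of "p - x"] reflect_in_interval[OF xy'(2), of "q - y"] small by simp
    qed
    have each: "\<bar>?I (fh (Suc n)) p q - ?F p q\<bar> \<le> E + 2 * K3" if "(p, q) \<in> set bp" for p q
    proof -
      note D = in_domain[OF that]
      have "\<bar>?I (fh (Suc n)) p q - ?I ?f p q\<bar> \<le> E"
        unfolding bilinear_diff
        by (rule bilinear_abs_le) (use D box M' E t(4) in auto)
      moreover have "\<bar>?I ?f p q - ?F p q\<bar> \<le> 2 * K * h\<^sup>2"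
        by (rule bilinear_error) (use D M' h t in auto)
      ultimately show ?thesis using Kh by linarith
    qed
    \<comment> \<open>The factor \<open>1 + R h\<close> stays on the left until the end. Its part \<open>R h\<close> has been matched by the
        term \<open>r f\<close> of the equation, and it is at least \<open>1\<close> however large \<open>r\<close> is.\<close>
    have "length bp = 4" by (simp add: bp_def branch_points_def Let_def)
    then obtain p1 q1 p2 q2 p3 q3 p4 q4 where bp: "bp = [(p1, q1), (p2, q2), (p3, q3), (p4, q4)]"
      by (auto simp: numeral_eq_Suc length_Suc_conv)
    have "\<bar>4 * (1 + R * h) * fh n k l - (\<Sum>(p, q)\<leftarrow>bp. ?F p q)\<bar> \<le> 4 * (E + 2 * K3)"
      unfolding fh using each[of p1 q1] each[of p2 q2] each[of p3 q3] each[of p4 q4]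
      by (simp add: bp)
    then have "\<bar>4 * (1 + R * h) * fh n k l - 4 * ((1 + R * h) * d [] x y t)\<bar> \<le> 4 * (E + 2 * K3) + 1628 * K3"
      using sum by linarith
    also have "4 * (1 + R * h) * fh n k l - 4 * ((1 + R * h) * d [] x y t)
        = 4 * ((1 + R * h) * (fh n k l - d [] x y t))"
      by (simp add: algebra_simps)
    finally have le: "(1 + R * h) * \<bar>fh n k l - d [] x y t\<bar> \<le> E + 409 * K3"
      using R0 h0 by (simp add: abs_mult)
    have "\<bar>fh n k l - d [] x y t\<bar> \<le> (1 + R * h) * \<bar>fh n k l - d [] x y t\<bar>"
      using R0 h0 mult_right_mono[of 1 "1 + R * h" "\<bar>fh n k l - d [] x y t\<bar>"] by simp
    then show ?thesis using le by (simp add: x_def y_def)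
  qed
  \<comment> \<open>A boundary node copies an interior one, at a corner through two shifts: \<open>411 = 409 + 2\<close>.\<close>
  define k where "k = interior_index M1 i"
  define l where "l = interior_index M2 j"
  have k: "k \<in> {1..M1-1}" "k \<le> M1" and l: "l \<in> {1..M2-1}"
    using interior_index_range[OF M(1), of i] interior_index_range[OF M(2), of j] by (auto simp: k_def l_def)
  have "\<bar>d [] (node xL xR M1 k) (node yL yR M2 j) t - d [] (node xL xR M1 i) (node yL yR M2 j) t\<bar> \<le> K * h\<^sup>2"
    using boundary_increment_x[OF M(1) ij(1) node_in[OF box(2) M'(2) ij(2)] t(2)] by (simp add: k_def h)
  moreover have "\<bar>d [] (node xL xR M1 k) (node yL yR M2 l) t - d [] (node xL xR M1 k) (node yL yR M2 j) t\<bar> \<le> K * h\<^sup>2"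
    using boundary_increment_y[OF M(2) ij(2) node_in[OF box(1) M'(1) k(2)] t(2)] by (simp add: l_def h)
  moreover have "fh n i j = fh n k l"
    unfolding k_def l_def by (rule reflective_scheme_boundary[OF scheme n M ij])
  ultimately have "\<bar>fh n i j - d [] (node xL xR M1 i) (node yL yR M2 j) t\<bar> \<le> E + 411 * K3"
    using interior[OF k(1) l] Kh by linarith
  then show ?thesis by (simp add: t_def K3_def)
qed

end

section \<open>Convergence of the reflective scheme\<close>

theorem theorem3:
  fixes xL xR yL yR T :: real
    and \<rho> \<sigma>1 \<sigma>2 r b1 b2 f :: "real \<Rightarrow> real \<Rightarrow> real \<Rightarrow> real"
    and \<phi> :: "real \<Rightarrow> real \<Rightarrow> real"
  defines "\<Omega>T \<equiv> {xL<..<xR} \<times> {yL<..<yR} \<times> {0..<T}"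
  assumes domain: "xL < xR" "yL < yR" "T > 0"
    and coeff_continuous:
      "\<And>g. g \<in> {\<rho>, \<sigma>1, \<sigma>2, r, b1, b2} \<Longrightarrow> continuous_on \<Omega>T (\<lambda>(x, y, t). g x y t)"
    and coeff_range:
      "\<And>x y t. (x, y, t) \<in> \<Omega>T \<Longrightarrow>
         \<rho> x y t \<in> {-1..1} \<and> \<sigma>1 x y t > 0 \<and> \<sigma>2 x y t > 0 \<and> r x y t \<ge> 0"
    and coeff_bounded:
      "\<And>g. g \<in> {\<sigma>1, \<sigma>2, b1, b2} \<Longrightarrow> bounded ((\<lambda>(x, y, t). g x y t) ` \<Omega>T)"
    and pde: "satisfies_pde xL xR yL yR T \<rho> \<sigma>1 \<sigma>2 r b1 b2 f"
    and terminal: "\<And>x y. x \<in> {xL<..<xR} \<Longrightarrow> y \<in> {yL<..<yR} \<Longrightarrow> f x y T = \<phi> x y"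
    and neumann: "homogeneous_neumann xL xR yL yR T f"
    and smooth: "Ck_on 3 (\<lambda>(x, y, t). f x y t) ({xL..xR} \<times> {yL..yR} \<times> {0..T})"
    and payoff_continuous: "continuous_on ({xL..xR} \<times> {yL..yR}) (\<lambda>(x, y). \<phi> x y)"
  shows "\<exists>C>0. \<exists>\<delta>>0. \<forall>N M1 M2 fh.
           N \<ge> 1 \<and> M1 \<ge> 2 \<and> M2 \<ge> 2 \<and>
           mesh 0 T N = mesh xL xR M1 \<and> mesh 0 T N = mesh yL yR M2 \<and> mesh 0 T N < \<delta> \<and>
           reflective_scheme xL xR yL yR T \<rho> \<sigma>1 \<sigma>2 r b1 b2 \<phi> M1 M2 N fh \<longrightarrow>
           (\<forall>n\<le>N. max_error xL xR yL yR T M1 M2 N f fh n \<le> C * mesh 0 T N powr (1/2))"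
proof -
  obtain d where d: "d [] = f" and family: "derivative_family {xL..xR} {yL..yR} {0..T} 3 d"
    using Ck_on_derivative_family[OF smooth] by blast
  obtain K where K: "\<And>w x y t. length w \<le> 3 \<Longrightarrow> x \<in> {xL..xR} \<Longrightarrow> y \<in> {yL..yR} \<Longrightarrow> t \<in> {0..T} \<Longrightarrow>
      \<bar>d w x y t\<bar> \<le> K"
    using derivative_family_bounded[OF family] by (metis compact_Icc)
  interpret neumann_field xL xR yL yR T K d
    using domain family K homogeneous_neumann_closed[OF domain family _ neumann[folded d]]
    by unfold_locales auto
  obtain B where B: "B \<ge> 1" and coeff: "\<And>g x y t. g \<in> {\<sigma>1, \<sigma>2, b1, b2} \<Longrightarrow> (x, y, t) \<in> \<Omega>T \<Longrightarrow> \<bar>g x y t\<bar> \<le> B"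
  proof -
    have "\<exists>B. \<forall>p\<in>\<Omega>T. \<bar>(\<lambda>(x, y, t). g x y t) p\<bar> \<le> B" if "g \<in> {\<sigma>1, \<sigma>2, b1, b2}" for g
      using coeff_bounded[OF that] unfolding bounded_iff by (simp only: ball_simps real_norm_def)
    then obtain C where C: "\<And>g p. g \<in> {\<sigma>1, \<sigma>2, b1, b2} \<Longrightarrow> p \<in> \<Omega>T \<Longrightarrow> \<bar>(\<lambda>(x, y, t). g x y t) p\<bar> \<le> C g"
      by metis
    show ?thesis
    proof (rule that[of "Max {1, C \<sigma>1, C \<sigma>2, C b1, C b2}"])
      show "\<bar>g x y t\<bar> \<le> Max {1, C \<sigma>1, C \<sigma>2, C b1, C b2}"
        if "g \<in> {\<sigma>1, \<sigma>2, b1, b2}" "(x, y, t) \<in> \<Omega>T" for g x y t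
        using C[OF that] that(1) by (intro order_trans[OF _ Max_ge[of _ "C g"]]) auto
    qed simp
  qed
  \<comment> \<open>The scheme starts from \<open>\<phi>\<close> at the boundary nodes too.\<close>
  have terminal': "f x y T = \<phi> x y" if "x \<in> {xL..xR}" "y \<in> {yL..yR}" for x y
  proof -
    have f: "continuous_on ({xL..xR} \<times> {yL..yR} \<times> {0..T}) (\<lambda>(x, y, t). d [] x y t)"
      by (rule continuous_family) simp
    have "continuous_on ({xL..xR} \<times> {yL..yR}) (\<lambda>p. (fst p, snd p, T))"
      by (intro continuous_intros)
    then have "continuous_on ({xL..xR} \<times> {yL..yR}) (\<lambda>p. (\<lambda>(x, y, t). d [] x y t) (fst p, snd p, T))"
      by (rule continuous_on_compose2[OF f]) (use domain in auto)
    then have "continuous_on ({xL..xR} \<times> {yL..yR}) (\<lambda>(x, y). f x y T - \<phi> x y)"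
      using continuous_on_diff[OF _ payoff_continuous] by (fastforce simp: case_prod_unfold d)
    then have "f x y T - \<phi> x y = 0"
      by (rule zero_on_closed_rectangle[OF domain(1,2) _ _ that]) (use terminal in auto)
    then show ?thesis by simp
  qed
  define A where "A = 411 * K * B ^ 3"
  have A: "A \<ge> 0" using K_nonneg B by (simp add: A_def)
  \<comment> \<open>For \<open>h < \<delta>\<close> the displacements, of size at most \<open>3 B \<surd>h\<close>, do not exceed the sides of the rectangle,
      so that one reflection brings every branch point back.\<close>
  define \<delta> where "\<delta> = min 1 (min (((xR - xL) / (3 * B))\<^sup>2) (((yR - yL) / (3 * B))\<^sup>2))"
  have \<delta>: "\<delta> > 0" using domain B by (simp add: \<delta>_def)
  have "max_error xL xR yL yR T M1 M2 N f fh n \<le> (T * A + 1) * mesh 0 T N powr (1/2)"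
    if N: "N \<ge> 1" and M: "M1 \<ge> 2" "M2 \<ge> 2"
      and meshes: "mesh 0 T N = mesh xL xR M1" "mesh 0 T N = mesh yL yR M2" "mesh 0 T N < \<delta>"
      and scheme: "reflective_scheme xL xR yL yR T \<rho> \<sigma>1 \<sigma>2 r b1 b2 \<phi> M1 M2 N fh"
      and n: "n \<le> N" for N M1 M2 fh n
  proof -
    define h where "h = mesh 0 T N"
    have h: "0 < h" "h \<le> 1" "real N * h = T"
      using meshes(3) mesh_pos[OF domain(3) N] N by (auto simp: h_def \<delta>_def mesh_def)
    have small: "3 * B * sqrt h \<le> w"
      if "h < (w / (3 * B))\<^sup>2" "0 < w" for w
    proof -
      have "sqrt h \<le> w / (3 * B)" using that B by (intro real_le_lsqrt) auto
      then show ?thesis using B by (simp add: field_simps)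
    qed
    have small': "3 * B * sqrt h \<le> xR - xL" "3 * B * sqrt h \<le> yR - yL"
      using small meshes(3) domain by (auto simp: h_def \<delta>_def)
    have pde': "d [Dt] x y t + 1/2 * (\<sigma>1 x y t)\<^sup>2 * d [Dx, Dx] x y t
       + \<rho> x y t * \<sigma>1 x y t * \<sigma>2 x y t * d [Dx, Dy] x y t
       + 1/2 * (\<sigma>2 x y t)\<^sup>2 * d [Dy, Dy] x y t
       + b1 x y t * d [Dx] x y t + b2 x y t * d [Dy] x y t = r x y t * d [] x y t"
      if "x \<in> {xL<..<xR}" "y \<in> {yL<..<yR}" "t \<in> {0..<T}" for x y t
      by (rule satisfies_pde_family[OF pde[folded d] that])
    have coeff': "\<rho> x y t \<in> {-1..1} \<and> 0 \<le> r x y t \<and> \<bar>\<sigma>1 x y t\<bar> \<le> B \<and> \<bar>\<sigma>2 x y t\<bar> \<le> B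
        \<and> \<bar>b1 x y t\<bar> \<le> B \<and> \<bar>b2 x y t\<bar> \<le> B"
      if "x \<in> {xL<..<xR}" "y \<in> {yL<..<yR}" "t \<in> {0..<T}" for x y t
    proof -
      have "(x, y, t) \<in> \<Omega>T" using that by (simp add: \<Omega>T_def)
      then show ?thesis using coeff_range coeff by simp
    qed
    have "\<forall>i\<le>M1. \<forall>j\<le>M2. \<bar>fh m i j - f (node xL xR M1 i) (node yL yR M2 j) (node 0 T N m)\<bar>
        \<le> real (N - m) * (A * sqrt h ^ 3)" if "m \<le> N" for m
      using that
    proof (induction m rule: inc_induct)
      case base
      have "fh N i j = f (node xL xR M1 i) (node yL yR M2 j) (node 0 T N N)" if "i \<le> M1" "j \<le> M2" for i j
        using scheme[unfolded reflective_scheme_def, THEN conjunct1] that M node_last[OF N, of 0 T]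
          terminal'[OF node_in[OF domain(1), of M1 i] node_in[OF domain(2), of M2 j]] by simp
      then show ?case by simp
    next
      case (step m)
      have "real (N - m) * (A * sqrt h ^ 3) = real (N - Suc m) * (A * sqrt h ^ 3) + 411 * K * B ^ 3 * sqrt h ^ 3"
        using step by (simp add: A_def of_nat_diff algebra_simps)
      moreover have "\<bar>fh m i j - d [] (node xL xR M1 i) (node yL yR M2 j) (node 0 T N m)\<bar>
          \<le> real (N - Suc m) * (A * sqrt h ^ 3) + 411 * K * B ^ 3 * sqrt h ^ 3" if "i \<le> M1" "j \<le> M2" for i j
        by (rule error_step[OF scheme pde' coeff' B M h_def[symmetric] _ _ h(2) small' _ _ that])
           (use step meshes d in \<open>auto simp: h_def\<close>)
      ultimately show ?case by (simp add: d)
    qed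
    then have err: "\<bar>fh n i j - f (node xL xR M1 i) (node yL yR M2 j) (node 0 T N n)\<bar>
        \<le> real (N - n) * (A * sqrt h ^ 3)" if "i \<le> M1" "j \<le> M2" for i j
      using n that by blast
    \<comment> \<open>\<open>N = T / h\<close> steps turn the local order \<open>h\<^bsup>3/2\<^esup>\<close> into the global order \<open>h\<^bsup>1/2\<^esup>\<close>.\<close>
    have "real (N - n) * (A * sqrt h ^ 3) \<le> real N * (A * sqrt h ^ 3)"
      using A h by (intro mult_right_mono) auto
    also have "\<dots> = T * A * sqrt h"
    proof -
      have "sqrt h ^ 3 = h * sqrt h" using h(1) by (simp add: power3_eq_cube)
      then show ?thesis using h(3) by (simp add: algebra_simps)
    qed
    also have "\<dots> \<le> (T * A + 1) * sqrt h" using h(1) by (simp add: algebra_simps)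
    finally have le: "real (N - n) * (A * sqrt h ^ 3) \<le> (T * A + 1) * sqrt h" .
    have "\<bar>fh n i j - f (node xL xR M1 i) (node yL yR M2 j) (node 0 T N n)\<bar> \<le> (T * A + 1) * sqrt h"
      if "i \<le> M1" "j \<le> M2" for i j
      using err[OF that] le by linarith
    then have "max_error xL xR yL yR T M1 M2 N f fh n \<le> (T * A + 1) * sqrt h"
      unfolding max_error_def by (subst Max_le_iff) auto
    then show ?thesis using h(1) by (simp add: powr_half_sqrt h_def)
  qed
  note error = this
  show ?thesis
  proof (intro exI conjI allI impI)
    show "T * A + 1 > 0" using A domain by (simp add: add_nonneg_pos)
    show "\<delta> > 0" by fact
  qed (elim conjE, rule error)
qed

end
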